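(* Let $d \geq 2$ be an integer and let $\tau_1,\ldots,\tau_d$ be real numbers in $]0,1[$ such that $\tau_1 + \cdots + \tau_d > 1$. Let $f_1,\ldots,f_d$ be circle diffeomorphisms such that $f_k$ is of class $C^{1+\tau_k}$ for each $k \in \{1,\ldots,d\}$, the $f_k$ pairwise commute, and their rotation numbers $\rho(f_1),\ldots,\rho(f_d)$ are independent over the rationals. Then $f_1,\ldots,f_d$ are simultaneously topologically conjugate to rotations, i.e., there is a circle homeomorphism $\varphi$ such that $\varphi f_k \varphi^{-1}$ is a rotation for every $k$.
   Context: Circle diffeomorphisms are orientation preserving. A map is of class $C^{1+\tau}$ ($0<\tau<1$) if it is $C^1$ and its derivative is $\tau$-Hölder continuous. Elements $\rho_1,\ldots,\rho_d \in \mathbb{R}/\mathbb{Z}$ are independent over the rationals if no nontrivial linear combination of them with rational coefficients equals a rational number (i.e., if $q_1\rho_1+\cdots+q_d\rho_d \in \mathbb{Q}/\mathbb{Z}$ with $q_i \in \mathbb{Q}$, interpreted via real lifts, then all $q_i=0$). *)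

theory Defs
  imports "HOL-Analysis.Analysis"
begin

text \<open>The circle R/Z is modelled as the unit circle S^1 = sphere 0 1 in the complex plane,
  via the covering map x \<mapsto> cis (2 pi x).\<close>

abbreviation S1 :: "complex set" where "S1 \<equiv> sphere 0 1"

definition is_lift :: "(complex \<Rightarrow> complex) \<Rightarrow> (real \<Rightarrow> real) \<Rightarrow> bool" where
  "is_lift f F \<longleftrightarrow> continuous_on UNIV F \<and> (\<forall>x. F (x + 1) = F x + 1) \<and>
     (\<forall>x. f (cis (2 * pi * x)) = cis (2 * pi * F x))"

definition circle_diffeo_C1tau :: "real \<Rightarrow> (complex \<Rightarrow> complex) \<Rightarrow> bool" where
  "circle_diffeo_C1tau \<tau> f \<longleftrightarrow>
     (\<exists>F F'. is_lift f F \<and> (\<forall>x. (F has_real_derivative F' x) (at x)) \<and>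
        continuous_on UNIV F' \<and> (\<forall>x. F' x > 0) \<and>
        (\<exists>C. \<forall>x y. \<bar>F' x - F' y\<bar> \<le> C * \<bar>x - y\<bar> powr \<tau>))"

text \<open>Rotation number in [0,1) (representative of an element of R/Z), computed from a lift.\<close>
definition rot_num :: "(complex \<Rightarrow> complex) \<Rightarrow> real" where
  "rot_num f = frac (lim (\<lambda>n. (((SOME F. is_lift f F) ^^ n) 0) / real n))"

definition rat_independent :: "nat \<Rightarrow> (nat \<Rightarrow> real) \<Rightarrow> bool" where
  "rat_independent d \<rho> \<longleftrightarrow>
     (\<forall>q :: nat \<Rightarrow> real. (\<forall>k<d. q k \<in> \<rat>) \<and> (\<Sum>k<d. q k * \<rho> k) \<in> \<rat> \<longrightarrow> (\<forall>k<d. q k = 0))"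

end

theory Submission
  imports Defs
begin

text \<open>Commuting lifts \<open>F\<^sub>i\<close> with translation numbers \<open>\<rho>\<^sub>i\<close> admit a monotone map \<open>H\<close> of degree one with
  \<open>H \<circ> F\<^sub>i = H + \<rho>\<^sub>i\<close>; it is continuous because \<open>\<rho>\<^sub>0\<close> is irrational, and it remains to show that it
  is injective. If some level set \<open>I = H\<^sup>-\<^sup>1(c)\<close> is a nondegenerate interval, its images \<open>I\<^sub>n\<close> under
  the monoid \<open>\<nat>\<^sup>d\<close> are disjoint modulo 1 by independence, so their lengths have sum at most 1.
  Walking from 0 in \<open>\<nat>\<^sup>d\<close>, let a step in direction \<open>i\<close> from \<open>n\<close> cost \<open>|I\<^sub>n|\<close> to the power \<open>\<tau>\<^sub>i\<close>: this
  bounds the distortion caused by applying \<open>F\<^sub>i\<close> near \<open>I\<^sub>n\<close>. In a box with sides proportional to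
  \<open>R\<close> to the power \<open>\<tau>\<^sub>i\<close>, a typical line in direction \<open>i\<close> costs only a negative power of \<open>R\<close>, since
  the \<open>\<tau>\<^sub>i\<close> add up to more than 1. Chaining random lines at dyadic scales gives arbitrarily long paths
  of uniformly bounded cost, each ending with a long segment in direction 0. Along them a fixed right
  neighbourhood of \<open>I\<close> is never stretched beyond the length of the image of \<open>I\<close>. By density of the
  orbits of the rotation by \<open>\<rho>\<^sub>0\<close>, the image of \<open>I\<close> can be made to land just to the right of \<open>I\<close>, inside
  that neighbourhood, and this produces a fixed point of an element that acts on \<open>H\<close> as a
  nontrivial translation.\<close>

section \<open>Paths of bounded cost\<close>

text \<open>The origin is \<open>undefined\<close> outside \<open>{..<d}\<close>, so every path
  stays among the extensional functions that make up the boxes \<open>PiE\<close>. A step is charged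
  at the point it leaves, where the map is about to be applied.\<close>

inductive path_cost :: "nat \<Rightarrow> ((nat \<Rightarrow> nat) \<Rightarrow> real) \<Rightarrow> (nat \<Rightarrow> real) \<Rightarrow> (nat \<Rightarrow> nat) \<Rightarrow> real \<Rightarrow> bool"
  for d l \<tau> where
  start: "path_cost d l \<tau> (\<lambda>i\<in>{..<d}. 0) 0"
| step: "path_cost d l \<tau> n s \<Longrightarrow> i < d \<Longrightarrow> path_cost d l \<tau> (n(i := Suc (n i))) (s + l n powr \<tau> i)"

lemma path_cost_line:
  assumes "path_cost d l \<tau> n s" "i < d"
  shows "path_cost d l \<tau> (n(i := n i + k)) (s + (\<Sum>j<k. l (n(i := n i + j)) powr \<tau> i))"
proof (induction k)
  case 0
  then show ?case using assms by simp
next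
  case (Suc k)
  have "(n(i := n i + k))(i := Suc ((n(i := n i + k)) i)) = n(i := n i + Suc k)" by simp
  with path_cost.step[OF Suc assms(2)] show ?case by (simp only: sum.lessThan_Suc add.assoc)
qed

section \<open>Sums over boxes and sums of powers\<close>

lemma sum_PiE_split:
  assumes "i \<in> I"
  shows "sum f (PiE I (T(i := V))) = (\<Sum>x\<in>PiE (I - {i}) T. \<Sum>v\<in>V. f (x(i := v)))"
proof -
  have I: "I = insert i (I - {i})" using assms by auto
  have eq: "PiE I (T(i := V)) = (\<lambda>(y, g). g(i := y)) ` (V \<times> PiE (I - {i}) T)"
  proof -
    have "PiE (I - {i}) (T(i := V)) = PiE (I - {i}) T" by (rule PiE_cong) auto
    then show ?thesis using PiE_insert_eq[of i "I - {i}" "T(i := V)"] I by simp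
  qed
  have "inj_on (\<lambda>(y, g). g(i := y)) (V \<times> PiE (I - {i}) T)"
  proof (rule inj_onI, clarify)
    fix v g v' g'
    assume g: "g \<in> PiE (I - {i}) T" "g' \<in> PiE (I - {i}) T" and eq: "g(i := v) = g'(i := v')"
    have "g i = undefined" "g' i = undefined" using g by (auto simp: PiE_def extensional_def)
    then have "g = g'" using eq by (metis fun_upd_triv fun_upd_upd)
    moreover have "v = v'" using eq by (metis fun_upd_same)
    ultimately show "v = v' \<and> g = g'" by simp
  qed
  then have "sum f (PiE I (T(i := V))) = (\<Sum>(v, x)\<in>V \<times> PiE (I - {i}) T. f (x(i := v)))"
    unfolding eq by (subst sum.reindex) (auto simp: case_prod_unfold intro!: sum.cong)
  also have "\<dots> = (\<Sum>v\<in>V. \<Sum>x\<in>PiE (I - {i}) T. f (x(i := v)))"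
    by (rule sum.cartesian_product[symmetric])
  finally show ?thesis by (subst sum.swap)
qed

text \<open>Below the threshold \<open>s\<close> the power is monotone; above it, it is
  \<open>x\<close> times the decreasing function \<open>x powr (t - 1)\<close>. The bound is affine
  in \<open>x\<close>, so it can be summed.\<close>

lemma powr_le_threshold:
  fixes x s t :: real
  assumes "x \<ge> 0" "s > 0" "0 < t" "t < 1"
  shows "x powr t \<le> s powr t + x * s powr (t - 1)"
proof (cases "x \<le> s")
  case True
  then have "x powr t \<le> s powr t" using assms by (intro powr_mono2) auto
  moreover have "0 \<le> x * s powr (t - 1)" using assms by simp
  ultimately show ?thesis by linarith
next
  case False
  then have "x powr t = x * x powr (t - 1)" using assms by (simp add: powr_diff)
  also have "\<dots> \<le> x * s powr (t - 1)"
    using False assms by (intro mult_left_mono powr_mono2') auto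
  finally show ?thesis using powr_ge_zero[of s t] by linarith
qed

text \<open>This replaces Hoelder's inequality up to the factor 2: with threshold
  \<open>1 / card Y\<close> the constant and the linear part each contribute at most
  \<open>card Y powr (1 - t)\<close>.\<close>

lemma sum_powr_le_card:
  fixes l :: "'a \<Rightarrow> real"
  assumes "finite Y" "\<And>y. y \<in> Y \<Longrightarrow> l y \<ge> 0" "sum l Y \<le> 1" "0 < t" "t < 1"
  shows "(\<Sum>y\<in>Y. l y powr t) \<le> 2 * real (card Y) powr (1 - t)"
proof (cases "Y = {}")
  case False
  define c where "c = real (card Y)"
  have c: "c > 0" using False assms(1) by (simp add: c_def card_gt_0_iff)
  have "(\<Sum>y\<in>Y. l y powr t) \<le> (\<Sum>y\<in>Y. (1/c) powr t + l y * (1/c) powr (t - 1))"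
    using assms c by (intro sum_mono powr_le_threshold) auto
  also have "\<dots> = c * (1/c) powr t + sum l Y * (1/c) powr (t - 1)"
    by (simp add: sum.distrib sum_distrib_right c_def)
  also have "\<dots> \<le> c * (1/c) powr t + 1 * (1/c) powr (t - 1)"
    using assms by (intro add_left_mono mult_right_mono) auto
  also have "\<dots> = 2 * c powr (1 - t)"
    using c by (simp add: powr_diff powr_divide)
  finally show ?thesis by (simp add: c_def)
qed auto

text \<open>The shift by one makes scale 0 equal to \<open>{0}\<close>, the starting point. For
  \<open>a \<ge> 1\<close> each side lies before that of the next scale, as required by paths that
  only increase coordinates.\<close>

definition scale_side :: "nat \<Rightarrow> nat \<Rightarrow> nat set" where
  "scale_side a m = {2 ^ (m * a) - 1..<2 * 2 ^ (m * a) - 1}"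

lemma card_scale_side: "card (scale_side a m) = 2 ^ (m * a)"
  by (simp add: scale_side_def)

lemma finite_scale_side [simp]: "finite (scale_side a m)"
  by (simp add: scale_side_def)

lemma scale_side_le:
  assumes "a \<ge> 1" "t \<in> scale_side a m" "v \<in> scale_side a (Suc m)"
  shows "t \<le> v"
proof -
  have "(2::nat) ^ (Suc m * a) = 2 ^ a * 2 ^ (m * a)" by (simp add: power_add)
  moreover have "(2::nat) ^ a \<ge> 2 ^ 1" using assms(1) by (intro power_increasing) auto
  ultimately have "2 * 2 ^ (m * a) \<le> (2::nat) ^ (Suc m * a)" by simp
  then show ?thesis using assms(2,3) unfolding scale_side_def by auto
qed

section \<open>Average cost of paths in boxes\<close>

locale summable_weights =
  fixes d :: nat and l :: "(nat \<Rightarrow> nat) \<Rightarrow> real" and \<tau> :: "nat \<Rightarrow> real"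
  assumes d_pos: "0 < d"
    and weight_nonneg: "l n \<ge> 0"
    and weight_sum: "finite Y \<Longrightarrow> Y \<subseteq> PiE {..<d} (\<lambda>_. UNIV) \<Longrightarrow> sum l Y \<le> 1"
    and tau_pos: "i < d \<Longrightarrow> 0 < \<tau> i"
    and tau_less: "i < d \<Longrightarrow> \<tau> i < 1"
    and tau_sum: "(\<Sum>i<d. \<tau> i) > 1"
begin

abbreviation "grid T \<equiv> PiE {..<d} T"

text \<open>Averaging the cost over all endpoints in a grid replaces a random choice of the path.\<close>

definition cheap :: "(nat \<Rightarrow> nat set) \<Rightarrow> real \<Rightarrow> bool" where
  "cheap T A \<longleftrightarrow> (\<exists>g. (\<forall>x\<in>grid T. \<exists>s\<le>g x. path_cost d l \<tau> x s) \<and> sum g (grid T) \<le> A * card (grid T))"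

text \<open>If \<open>b\<close> lines in direction \<open>i\<close> meet \<open>U * b\<close>
  points, this is the bound \<open>2 * (U * b) powr (1 - \<tau> i)\<close> for their total cost,
  divided by \<open>b\<close>.\<close>

definition line_avg :: "(nat \<Rightarrow> nat set) \<Rightarrow> nat \<Rightarrow> nat \<Rightarrow> real" where
  "line_avg T i U = 2 * U * (U * real (\<Prod>j\<in>{..<d} - {i}. card (T j))) powr (- \<tau> i)"

definition line_cost :: "nat \<Rightarrow> nat \<Rightarrow> (nat \<Rightarrow> nat) \<Rightarrow> real" where
  "line_cost i U x = (\<Sum>k<U. l (x(i := k)) powr \<tau> i)"

lemma line_cost_upd [simp]: "line_cost i U (x(i := v)) = line_cost i U x"
  by (simp add: line_cost_def)

lemma sum_line_cost:
  assumes i: "i < d" and fin: "\<And>j. j < d \<Longrightarrow> finite (T j)"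
  shows "(\<Sum>x\<in>PiE ({..<d} - {i}) T. line_cost i U x)
         \<le> line_avg T i U * card (PiE ({..<d} - {i}) T)"
proof -
  let ?Y = "grid (T(i := {..<U}))"
  let ?b = "real (card (PiE ({..<d} - {i}) T))"
  have b: "?b = real (\<Prod>j\<in>{..<d} - {i}. card (T j))" by (simp add: card_PiE)
  have finY: "finite ?Y" using fin by (intro finite_PiE) auto
  have cY: "real (card ?Y) = U * ?b"
    using sum_PiE_split[of i "{..<d}" "\<lambda>_. 1::nat" T "{..<U}"] i by simp
  have "(\<Sum>x\<in>PiE ({..<d} - {i}) T. line_cost i U x) = (\<Sum>y\<in>?Y. l y powr \<tau> i)"
    using i by (simp add: line_cost_def sum_PiE_split)
  also have "\<dots> \<le> 2 * real (card ?Y) powr (1 - \<tau> i)"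
  proof (rule sum_powr_le_card[OF finY])
    show "sum l ?Y \<le> 1" using finY by (intro weight_sum) auto
  qed (use i tau_pos tau_less weight_nonneg in auto)
  also have "\<dots> = line_avg T i U * ?b"
    unfolding cY line_avg_def b[symmetric] 
    by (cases "U = 0 \<or> ?b = 0") (auto simp: powr_diff powr_minus field_simps)
  finally show ?thesis .
qed

text \<open>To reach \<open>x\<close>, start on the line through \<open>x\<close> in direction
  \<open>i\<close> from a coordinate \<open>t\<close> in \<open>T i\<close> whose old bound is at
  most the mean over \<open>T i\<close>, and walk forward. The walk costs at most the full line, so
  the averages add up.\<close>

lemma cheap_step:
  assumes "cheap T A" and i: "i < d" and fin: "\<And>j. j < d \<Longrightarrow> finite (T j)" and ne: "T i \<noteq> {}"
    and V: "V \<subseteq> {..<U}" and le: "\<And>t v. t \<in> T i \<Longrightarrow> v \<in> V \<Longrightarrow> t \<le> v"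
  shows "cheap (T(i := V)) (A + line_avg T i U)"
proof -
  from assms(1) obtain g where g: "\<And>x. x \<in> grid T \<Longrightarrow> \<exists>s\<le>g x. path_cost d l \<tau> x s"
    and sg: "sum g (grid T) \<le> A * card (grid T)" unfolding cheap_def by auto
  let ?B = "PiE ({..<d} - {i}) T"
  define c where "c = real (card (T i))"
  have c: "c > 0" using ne fin[OF i] by (simp add: c_def card_gt_0_iff)
  define g' where "g' x = (\<Sum>t\<in>T i. g (x(i := t))) / c + line_cost i U x" for x
  have cT: "real (card (grid T)) = c * card ?B"
    using sum_PiE_split[of i "{..<d}" "\<lambda>_. 1::nat" T "T i"] i by (simp add: c_def)
  have cV: "real (card (grid (T(i := V)))) = card V * real (card ?B)"
    using sum_PiE_split[of i "{..<d}" "\<lambda>_. 1::nat" T V] i by simp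
  have "\<exists>s\<le>g' x. path_cost d l \<tau> x s" if x: "x \<in> grid (T(i := V))" for x
  proof -
    have xi: "x i \<in> V" using x i by (auto simp: PiE_def Pi_def)
    have "\<exists>t\<in>T i. g (x(i := t)) \<le> (\<Sum>t\<in>T i. g (x(i := t))) / c"
    proof (rule ccontr)
      assume "\<not> ?thesis"
      then have "(\<Sum>t\<in>T i. (\<Sum>t\<in>T i. g (x(i := t))) / c) < (\<Sum>t\<in>T i. g (x(i := t)))"
        using ne fin[OF i] by (intro sum_strict_mono) auto
      then show False using c by (simp add: c_def)
    qed
    then obtain t where t: "t \<in> T i" "g (x(i := t)) \<le> (\<Sum>t\<in>T i. g (x(i := t))) / c" by auto
    have "x(i := t) \<in> grid T" using x t i by (auto simp: PiE_def Pi_def extensional_def split: if_splits)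
    from g[OF this] obtain s where s: "s \<le> g (x(i := t))" "path_cost d l \<tau> (x(i := t)) s" by auto
    have tx: "t \<le> x i" "x i < U" using le[OF t(1) xi] V xi by auto
    from path_cost_line[OF s(2) i, of "x i - t"] tx
    have p: "path_cost d l \<tau> x (s + (\<Sum>j<x i - t. l (x(i := t + j)) powr \<tau> i))" by simp
    have "(\<Sum>j<x i - t. l (x(i := t + j)) powr \<tau> i) = (\<Sum>k\<in>(+) t ` {..<x i - t}. l (x(i := k)) powr \<tau> i)"
      by (subst sum.reindex) auto
    also have "\<dots> \<le> line_cost i U x"
      unfolding line_cost_def using tx by (intro sum_mono2) auto
    finally show ?thesis using p s(1) t(2) by (intro exI[of _ "s + _"] conjI) (auto simp: g'_def)
  qed
  moreover have "sum g' (grid (T(i := V))) \<le> (A + line_avg T i U) * card (grid (T(i := V)))"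
  proof -
    have "sum g' (grid (T(i := V))) = card V * (\<Sum>x\<in>?B. (\<Sum>t\<in>T i. g (x(i := t))) / c + line_cost i U x)"
      using i by (simp add: sum_PiE_split g'_def sum_distrib_left)
    also have "\<dots> = card V * (sum g (grid T) / c + (\<Sum>x\<in>?B. line_cost i U x))"
      using sum_PiE_split[of i "{..<d}" g T "T i"] i by (simp add: sum.distrib sum_divide_distrib)
    also have "\<dots> \<le> card V * (A * card ?B + line_avg T i U * card ?B)"
    proof (intro mult_left_mono add_mono sum_line_cost)
      show "sum g (grid T) / c \<le> A * card ?B" using sg c unfolding cT by (simp add: field_simps)
    qed (use i fin in auto)
    also have "\<dots> = (A + line_avg T i U) * card (grid (T(i := V)))" unfolding cV by (simp add: algebra_simps)
    finally show ?thesis .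
  qed
  ultimately show ?thesis unfolding cheap_def by blast
qed

text \<open>Grids with sides \<open>2 ^ (m * a i)\<close> have lines in direction \<open>i\<close> whose average cost decays
  geometrically in \<open>m\<close> as soon as \<open>a i < \<tau> i * sum a\<close>. This would hold for \<open>a = \<tau>\<close>; the exponents
  are integers so that the sides are, too.\<close>

lemma scaling_exponents:
  obtains a :: "nat \<Rightarrow> nat" where "\<And>i. i < d \<Longrightarrow> a i \<ge> 1"
    "\<And>i. i < d \<Longrightarrow> real (a i) < \<tau> i * (\<Sum>j<d. a j)"
proof -
  define A where "A = (\<Sum>i<d. \<tau> i)"
  \<comment> \<open>The exponents are the integer parts of \<open>N * \<tau> i\<close>. Rounding
    loses at most \<open>d\<close> in total, less than the surplus \<open>N * (A - 1)\<close>, so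
    they add up to more than \<open>N\<close>; the first condition on \<open>N\<close> keeps each of
    them positive.\<close>
  have "\<forall>i\<in>{..<d}. eventually (\<lambda>N. real N > 1 / \<tau> i) sequentially"
    using filterlim_real_sequentially by (simp add: filterlim_at_top_dense)
  then have "eventually (\<lambda>N. \<forall>i\<in>{..<d}. real N > 1 / \<tau> i) sequentially"
    by (subst eventually_ball_finite_distrib) auto
  moreover have "eventually (\<lambda>N. real N > d / (A - 1)) sequentially"
    using filterlim_real_sequentially by (simp add: filterlim_at_top_dense)
  ultimately have "eventually (\<lambda>N. (\<forall>i\<in>{..<d}. real N > 1 / \<tau> i) \<and> real N > d / (A - 1)) sequentially"
    by (rule eventually_conj)
  then obtain N :: nat where N: "\<And>i. i < d \<Longrightarrow> real N > 1 / \<tau> i" "real N > d / (A - 1)"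
    by (metis (mono_tags, lifting) eventually_happens' lessThan_iff sequentially_bot)
  define a where "a i = nat \<lfloor>N * \<tau> i\<rfloor>" for i
  have one: "N * \<tau> i \<ge> 1" if "i < d" for i
    using N(1)[OF that] tau_pos[OF that] by (simp add: field_simps)
  have a: "real (a i) \<le> N * \<tau> i" "real (a i) > N * \<tau> i - 1" "a i \<ge> 1" if "i < d" for i
    using one[OF that] unfolding a_def by (simp_all add: le_nat_iff le_floor_iff)
  have "(\<Sum>j<d. real (a j)) \<ge> (\<Sum>j<d. N * \<tau> j - 1)" using a(2) by (intro sum_mono) (simp add: less_imp_le)
  then have s: "(\<Sum>j<d. real (a j)) \<ge> N * A - d" by (simp add: sum_subtractf A_def sum_distrib_left)
  have "A > 1" using tau_sum by (simp add: A_def)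
  then have "N * A - d > N" using N(2) by (simp add: field_simps)
  with s have s: "(\<Sum>j<d. real (a j)) > N" by simp
  have "real (a i) < \<tau> i * (\<Sum>j<d. a j)" if "i < d" for i
  proof -
    have "\<tau> i * N < \<tau> i * (\<Sum>j<d. real (a j))" using s tau_pos[OF that] by simp
    then show ?thesis using a(1)[OF that] by (simp add: mult.commute)
  qed
  then show ?thesis using that a(3) by blast
qed

text \<open>From one scale to the next the sides change one coordinate at a time, at an average cost
  decaying geometrically. The series converges, so \<open>S\<close> does not depend on
  \<open>K\<close>; a last averaging picks an endpoint for which the path and the line in direction
  0 are cheap together.\<close>

lemma bounded_cost_reachable_lines:
  obtains S where "\<And>K. \<exists>p. \<forall>k\<le>K. \<exists>s\<le>S. path_cost d l \<tau> (p(0 := p 0 + k)) s"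
proof -
  obtain a where a1: "\<And>i. i < d \<Longrightarrow> a i \<ge> 1"
    and a2: "\<And>i. i < d \<Longrightarrow> real (a i) < \<tau> i * (\<Sum>j<d. a j)" by (rule scaling_exponents) auto
  \<comment> \<open>In the intermediate box \<open>T m i\<close> the coordinates below
    \<open>i\<close> are already at scale \<open>Suc m\<close>. All elements of the next side in
    direction \<open>i\<close> are below \<open>U m i\<close>.\<close>
  define T where "T m i = (\<lambda>j. scale_side (a j) (if j < i then Suc m else m))" for m i
  define U :: "nat \<Rightarrow> nat \<Rightarrow> nat" where "U m i = 2 * 2 ^ (Suc m * a i)" for m i
  define \<epsilon> where "\<epsilon> = Min ((\<lambda>i. \<tau> i * (\<Sum>j<d. a j) - a i) ` {..<d})"
  define M where "M = Max (a ` {..<d})"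
  define q where "q = (2::real) powr (- \<epsilon>)"
  have eps_le: "\<epsilon> \<le> \<tau> i * (\<Sum>j<d. a j) - a i" if "i < d" for i
    unfolding \<epsilon>_def using that by (intro Min_le) auto
  have "\<epsilon> > 0" unfolding \<epsilon>_def using d_pos a2 by (subst Min_gr_iff) auto
  then have q: "0 < q" "q < 1" by (auto simp: q_def powr_less_one)
  have M: "a i \<le> M" if "i < d" for i unfolding M_def using that by (intro Max_ge) auto
  define C where "C = 4 * (2::real) ^ M"
  have C: "C > 0" by (simp add: C_def)
  have avg: "line_avg (T m i) i (U m i) \<le> C * q ^ m" if i: "i < d" for m i
  proof -
    let ?s = "\<Sum>j<d. a j"
    \<comment> \<open>The lines fill a box with at least \<open>2 ^ (m * ?s)\<close> points and have
      length \<open>2 * 2 ^ a i * 2 ^ (m * a i)\<close>, so the average decays like 2 to the power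
      \<open>(a i - \<tau> i * ?s) * m\<close>; \<open>C\<close> bounds the remaining
      factors.\<close>
    let ?W = "U m i * (\<Prod>j\<in>{..<d} - {i}. card (T m i j))"
    have "(\<Prod>j\<in>{..<d}. 2 ^ (m * a j)) = 2 ^ (m * a i) * (\<Prod>j\<in>{..<d} - {i}. (2::nat) ^ (m * a j))"
      using i by (subst prod.remove[of _ i]) auto
    also have "\<dots> \<le> ?W"
    proof (intro mult_mono prod_mono conjI)
      have "(2::nat) ^ (m * a i) \<le> 2 ^ (Suc m * a i)" by (intro power_increasing) auto
      then show "2 ^ (m * a i) \<le> U m i" unfolding U_def by linarith
      show "2 ^ (m * a j) \<le> card (T m i j)" for j
        by (auto simp: T_def card_scale_side intro: power_increasing)
    qed auto
    finally have "2 ^ (m * ?s) \<le> ?W" by (simp add: power_sum sum_distrib_left)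
    then have W: "(2::real) ^ (m * ?s) \<le> real ?W"
      by (metis of_nat_le_iff of_nat_numeral of_nat_power)
    have "real ?W powr (- \<tau> i) \<le> (2 ^ (m * ?s)) powr (- \<tau> i)"
      using W tau_pos[OF i] by (intro powr_mono2') auto
    also have "\<dots> = 2 powr (- \<tau> i * ?s * m)"
      by (simp add: powr_powr mult_ac flip: powr_realpow)
    finally have "line_avg (T m i) i (U m i) \<le> 2 * real (U m i) * 2 powr (- \<tau> i * ?s * m)"
      unfolding line_avg_def of_nat_mult by (rule mult_left_mono) simp
    also have "\<dots> = 4 * 2 ^ a i * (2 powr (a i * m) * 2 powr (- \<tau> i * ?s * m))"
      by (simp add: U_def power_add powr_realpow[symmetric] mult_ac)
    also have "\<dots> = 4 * 2 ^ a i * 2 powr ((a i - \<tau> i * ?s) * m)"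
      by (simp add: powr_add[symmetric] algebra_simps)
    also have "\<dots> \<le> 4 * 2 ^ M * 2 powr (- \<epsilon> * m)"
    proof -
      have "(a i - \<tau> i * ?s) * m \<le> - \<epsilon> * m" using eps_le[OF i] by (intro mult_right_mono) auto
      then have "2 powr ((a i - \<tau> i * ?s) * m) \<le> (2::real) powr (- \<epsilon> * m)" by (intro powr_mono) auto
      moreover have "4 * (2::real) ^ a i \<le> 4 * 2 ^ M" using M[OF i] by (simp add: power_increasing)
      ultimately show ?thesis by (intro mult_mono) auto
    qed
    also have "\<dots> = C * q ^ m"
      by (simp add: C_def q_def powr_powr flip: powr_realpow)
    finally show ?thesis .
  qed
  have TS: "(T m i)(i := scale_side (a i) (Suc m)) = T m (Suc i)" for m i
    by (auto simp: T_def fun_eq_iff less_Suc_eq)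
  have inner: "cheap (T m i) (A + i * (C * q ^ m))" if "cheap (T m 0) A" "i \<le> d" for m i A
    using that(2)
  proof (induction i)
    case 0
    then show ?case using that by simp
  next
    case (Suc i)
    then have i: "i < d" by simp
    have "cheap ((T m i)(i := scale_side (a i) (Suc m))) (A + i * (C * q ^ m) + line_avg (T m i) i (U m i))"
    proof (rule cheap_step[OF Suc.IH i])
      show "T m i i \<noteq> {}" using card_scale_side[of "a i" m] by (auto simp: T_def)
      show "t \<le> v" if "t \<in> T m i i" "v \<in> scale_side (a i) (Suc m)" for t v
        using scale_side_le[OF a1[OF i]] that by (auto simp: T_def)
    qed (use Suc in \<open>auto simp: T_def U_def scale_side_def\<close>)
    then have "cheap (T m (Suc i)) (A + i * (C * q ^ m) + line_avg (T m i) i (U m i))" by (simp only: TS)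
    then show ?case unfolding cheap_def
    proof (elim exE conjE, intro exI conjI)
      fix g assume "sum g (grid (T m (Suc i))) \<le> (A + i * (C * q ^ m) + line_avg (T m i) i (U m i)) * card (grid (T m (Suc i)))"
      also have "\<dots> \<le> (A + Suc i * (C * q ^ m)) * card (grid (T m (Suc i)))"
        using avg[OF i, of m] by (intro mult_right_mono) (auto simp: algebra_simps)
      finally show "sum g (grid (T m (Suc i))) \<le> \<dots>" .
    qed
  qed
  \<comment> \<open>The two families of sides differ at indices from \<open>d\<close> on, so only
    the boxes are equal.\<close>
  have grid_Suc: "grid (T m d) = grid (T (Suc m) 0)" for m
    by (rule PiE_cong) (auto simp: T_def)
  have cheap_scale: "cheap (T m 0) (d * C * (\<Sum>k<m. q ^ k))" for m
  proof (induction m)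
    case 0
    have "grid (T 0 0) = {\<lambda>i\<in>{..<d}. 0}"
      by (subst PiE_eq_singleton) (auto simp: T_def scale_side_def)
    then show ?case unfolding cheap_def
      by (intro exI[of _ "\<lambda>_. 0"]) (auto intro: path_cost.start)
  next
    case (Suc m)
    from inner[OF Suc order_refl] show ?case
      unfolding cheap_def grid_Suc by (simp add: algebra_simps)
  qed
  \<comment> \<open>The first summand bounds the average cost of reaching scale \<open>K\<close>,
    the second that of a line in direction 0 there.\<close>
  define S where "S = d * C * (1 / (1 - q)) + C"
  have "\<exists>p. \<forall>k\<le>K. \<exists>s\<le>S. path_cost d l \<tau> (p(0 := p 0 + k)) s" for K
  proof -
    let ?T = "T K 0"
    have geo: "(\<Sum>k<K. q ^ k) \<le> 1 / (1 - q)"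
      using q by (simp add: sum_gp_strict divide_right_mono)
    from cheap_scale[of K] obtain g where g: "\<And>x. x \<in> grid ?T \<Longrightarrow> \<exists>s\<le>g x. path_cost d l \<tau> x s"
      and sg: "sum g (grid ?T) \<le> (d * C * (\<Sum>k<K. q ^ k)) * card (grid ?T)" unfolding cheap_def by auto
    have finT: "finite (grid ?T)" by (intro finite_PiE) (auto simp: T_def)
    have "card (grid ?T) > 0" by (simp add: card_PiE T_def card_scale_side)
    then have neT: "grid ?T \<noteq> {}" by (metis card.empty less_irrefl)
    have cT: "real (card (grid ?T)) = card (?T 0) * card (PiE ({..<d} - {0}) ?T)"
      using sum_PiE_split[of 0 "{..<d}" "\<lambda>_. 1::nat" ?T "?T 0"] d_pos by simp
    have "sum (line_cost 0 (U K 0)) (grid ?T) = card (?T 0) * (\<Sum>x\<in>PiE ({..<d} - {0}) ?T. line_cost 0 (U K 0) x)"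
      using sum_PiE_split[of 0 "{..<d}" "line_cost 0 (U K 0)" ?T "?T 0"] d_pos by (simp add: sum_distrib_left)
    also have "\<dots> \<le> card (?T 0) * (line_avg ?T 0 (U K 0) * card (PiE ({..<d} - {0}) ?T))"
      using d_pos by (intro mult_left_mono sum_line_cost) (auto simp: T_def)
    also have "\<dots> \<le> card (?T 0) * (C * card (PiE ({..<d} - {0}) ?T))"
    proof (intro mult_left_mono mult_right_mono)
      have "q ^ K \<le> 1" using q by (simp add: power_le_one)
      then have "C * q ^ K \<le> C" using C by simp
      then show "line_avg ?T 0 (U K 0) \<le> C" using avg[OF d_pos, of K] by linarith
    qed auto
    finally have "sum (line_cost 0 (U K 0)) (grid ?T) \<le> C * card (grid ?T)" by (simp add: cT mult_ac)
    moreover have "sum g (grid ?T) \<le> (d * C * (1 / (1 - q))) * card (grid ?T)"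
    proof (rule order_trans[OF sg])
      show "(d * C * (\<Sum>k<K. q ^ k)) * card (grid ?T) \<le> (d * C * (1 / (1 - q))) * card (grid ?T)"
        using geo C by (intro mult_right_mono mult_left_mono) auto
    qed
    ultimately have tot: "(\<Sum>x\<in>grid ?T. g x + line_cost 0 (U K 0) x) \<le> (\<Sum>x\<in>grid ?T. S)"
      by (simp add: sum.distrib S_def algebra_simps)
    have "\<exists>p\<in>grid ?T. g p + line_cost 0 (U K 0) p \<le> S"
    proof (rule ccontr)
      assume "\<not> ?thesis"
      then have "(\<Sum>x\<in>grid ?T. S) < (\<Sum>x\<in>grid ?T. g x + line_cost 0 (U K 0) x)"
        using neT finT by (intro sum_strict_mono) auto
      then show False using tot by simp
    qed
    then obtain p where p: "p \<in> grid ?T" "g p + line_cost 0 (U K 0) p \<le> S" by auto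
    from g[OF p(1)] obtain s where s: "s \<le> g p" "path_cost d l \<tau> p s" by auto
    have "p 0 \<in> ?T 0" using p(1) d_pos by (auto simp: PiE_def Pi_def)
    then have p0: "p 0 < 2 * 2 ^ (K * a 0)" by (auto simp: T_def scale_side_def)
    \<comment> \<open>Coordinate 0 of \<open>p\<close> is below half of \<open>U K 0\<close>, and
      \<open>K < 2 ^ (K * a 0)\<close>; hence the segment of length \<open>K\<close> from
      \<open>p\<close> lies on the line already paid for.\<close>
    have U2: "2 * (2 * 2 ^ (K * a 0)) \<le> U K 0"
      using power_increasing[of 1 "a 0" "2::nat"] a1[OF d_pos] by (simp add: U_def power_add)
    have "K \<le> K * a 0" using a1[OF d_pos] by simp
    also have "\<dots> < 2 ^ (K * a 0)" by (rule less_exp)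
    finally have KU: "p 0 + K \<le> U K 0" using p0 U2 by linarith
    have "\<exists>s\<le>S. path_cost d l \<tau> (p(0 := p 0 + k)) s" if k: "k \<le> K" for k
    proof -
      have "(\<Sum>j<k. l (p(0 := p 0 + j)) powr \<tau> 0) = (\<Sum>j\<in>(+) (p 0) ` {..<k}. l (p(0 := j)) powr \<tau> 0)"
        by (subst sum.reindex) auto
      also have "\<dots> \<le> line_cost 0 (U K 0) p"
        unfolding line_cost_def using k KU by (intro sum_mono2) auto
      finally show ?thesis using path_cost_line[OF s(2) d_pos, of k] s(1) p(2)
        by (intro exI[of _ "s + _"] conjI) auto
    qed
    then show ?thesis by blast
  qed
  then show ?thesis using that by blast
qed

end

section \<open>Monotone maps of degree one\<close>

text \<open>Jumps are allowed because the semiconjugacy first appears as an upper limit, known only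
  to be monotone.\<close>

definition degree_one :: "(real \<Rightarrow> real) \<Rightarrow> bool" where
  "degree_one F \<longleftrightarrow> mono F \<and> (\<forall>x. F (x + 1) = F x + 1)"

lemma shift_of_int:
  fixes F :: "real \<Rightarrow> real"
  assumes "\<And>x. F (x + 1) = F x + 1"
  shows "F (x + of_int k) = F x + of_int k"
proof -
  have nat: "F (x + real n) = F x + real n" for x n
  proof (induction n)
    case (Suc n)
    then show ?case using assms[of "x + real n"] by (simp add: add_ac)
  qed simp
  show ?thesis
  proof (cases "k \<ge> 0")
    case True
    then show ?thesis using nat[of x "nat k"] by simp
  next
    case False
    then show ?thesis using nat[of "x + of_int k" "nat (- k)"] by simp
  qed
qed

lemma degree_one_of_int: "degree_one F \<Longrightarrow> F (x + of_int k) = F x + of_int k"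
  by (rule shift_of_int) (simp add: degree_one_def)

text \<open>If \<open>y + k \<le> x \<le> y + k + 1\<close> with an integer \<open>k\<close>,
  monotonicity puts \<open>F x\<close> between \<open>F y + k\<close> and
  \<open>F y + k + 1\<close>.\<close>

lemma degree_one_displacement:
  assumes "degree_one F"
  shows "\<bar>(F x - x) - (F y - y)\<bar> \<le> 1"
proof -
  define k where "k = \<lfloor>x - y\<rfloor>"
  have k: "y + of_int k \<le> x" "x \<le> y + of_int (k + 1)" unfolding k_def by linarith+
  have m: "mono F" using assms by (simp add: degree_one_def)
  have "F y + of_int k \<le> F x" "F x \<le> F y + of_int (k + 1)"
    using monoD[OF m k(1)] monoD[OF m k(2)] by (simp_all only: degree_one_of_int[OF assms])
  then show ?thesis using k by (simp add: abs_le_iff)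
qed

lemma degree_one_surj:
  assumes F: "degree_one F" and cont: "continuous_on UNIV F"
  shows "surj F"
proof (rule surjI[of _ "\<lambda>y. SOME x. F x = y"], rule someI_ex)
  fix y
  define k where "k = \<lfloor>y - F 0\<rfloor>"
  have "F (of_int k) \<le> y" "y \<le> F (of_int (k + 1))"
    using degree_one_of_int[OF F, of 0 k] degree_one_of_int[OF F, of 0 "k + 1"]
    unfolding k_def by simp_all linarith+
  then show "\<exists>x. F x = y"
    using IVT'[of F "of_int k" y "of_int (k + 1)"] cont by (auto intro: continuous_on_subset)
qed

lemma degree_one_funpow: "degree_one F \<Longrightarrow> degree_one (F ^^ n)"
  by (induction n) (auto simp: degree_one_def mono_def)

text \<open>Displacements of iterates add up with errors of at most 1. Comparing
  \<open>D (m * n)\<close> with \<open>m * D n\<close> and with \<open>n * D m\<close> makes the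
  quotients \<open>D n x / n\<close> a Cauchy sequence; letting \<open>m\<close> tend to infinity in
  the same estimate gives the error 1 for every \<open>n\<close>.\<close>

lemma translation_number_exists:
  assumes F: "degree_one F"
  obtains r :: real where "\<And>n x. \<bar>(F ^^ n) x - x - n * r\<bar> \<le> 1" "(\<lambda>n. (F ^^ n) 0 / real n) \<longlonglongrightarrow> r"
proof -
  define D where "D n x = (F ^^ n) x - x" for n x
  have disp: "\<bar>D n x - D n y\<bar> \<le> 1" for n x y
    using degree_one_displacement[OF degree_one_funpow[OF F]] by (simp add: D_def)
  have mult: "\<bar>D (m * n) x - m * D n x\<bar> \<le> m" for m n x
  proof (induction m)
    case 0
    then show ?case by (simp add: D_def)
  next
    case (Suc m)
    have "D (Suc m * n) x = D n ((F ^^ (m * n)) x) + D (m * n) x"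
      by (simp add: D_def funpow_add)
    then show ?case using Suc disp[of n "(F ^^ (m * n)) x" x] by (simp add: algebra_simps abs_le_iff)
  qed
  have dist: "\<bar>D m x / m - D n x / n\<bar> \<le> 1 / m + 1 / n" if "m > 0" "n > 0" for m n x
  proof -
    have "\<bar>n * D m x - m * D n x\<bar> \<le> real m + real n"
      using mult[of m n x] mult[of n m x] by (simp add: mult.commute abs_le_iff)
    moreover have "D m x / m - D n x / n = (n * D m x - m * D n x) / (real m * real n)"
      using that by (simp add: field_simps)
    ultimately have "\<bar>D m x / m - D n x / n\<bar> \<le> (real m + real n) / (real m * real n)"
      using that by (simp add: divide_right_mono)
    also have "\<dots> = 1 / m + 1 / n" using that by (simp add: field_simps)
    finally show ?thesis .
  qed
  have inv: "(\<lambda>n. 1 / real n) \<longlonglongrightarrow> 0" by (rule lim_1_over_n)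
  have "Cauchy (\<lambda>n. D n 0 / real n)"
  proof (rule metric_CauchyI)
    fix e :: real assume "e > 0"
    then obtain N :: nat where N: "N > 0" "1 / real N < e / 2"
      by (metis half_gt_zero inverse_eq_divide real_arch_inverse zero_less_iff_neq_zero)
    have "dist (D m 0 / m) (D n 0 / n) < e" if "m \<ge> N" "n \<ge> N" for m n
    proof -
      have "1 / real m \<le> 1 / real N" "1 / real n \<le> 1 / real N" using that N(1) by (auto simp: frac_le)
      then show ?thesis using dist[of m n 0] that N by (simp add: dist_real_def)
    qed
    then show "\<exists>M. \<forall>m\<ge>M. \<forall>n\<ge>M. dist (D m 0 / m) (D n 0 / n) < e" by blast
  qed
  then obtain r where r: "(\<lambda>n. D n 0 / real n) \<longlonglongrightarrow> r" by (auto simp: Cauchy_convergent_iff convergent_def)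
  have lim: "(\<lambda>n. D n x / real n) \<longlonglongrightarrow> r" for x
  proof -
    have "(\<lambda>n. D n x / real n - D n 0 / real n) \<longlonglongrightarrow> 0"
    proof (rule Lim_null_comparison[OF _ inv], rule always_eventually, rule allI)
      show "norm (D n x / real n - D n 0 / real n) \<le> 1 / real n" for n
        using disp[of n x 0] by (simp add: diff_divide_distrib[symmetric] divide_right_mono)
    qed
    from tendsto_add[OF this r] show ?thesis by simp
  qed
  have "\<bar>D n x - n * r\<bar> \<le> 1" for n x
  proof (cases "n = 0")
    case False
    have "(\<lambda>m. \<bar>D n x / n - D m x / m\<bar>) \<longlonglongrightarrow> \<bar>D n x / n - r\<bar>"
      by (intro tendsto_intros lim)
    moreover have "(\<lambda>m. 1 / n + 1 / real m) \<longlonglongrightarrow> 1 / n + 0" by (intro tendsto_intros inv)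
    moreover have "\<forall>\<^sub>F m in sequentially. \<bar>D n x / n - D m x / m\<bar> \<le> 1 / n + 1 / real m"
      using eventually_gt_at_top[of 0] by eventually_elim (use dist False in auto)
    ultimately have "\<bar>D n x / n - r\<bar> \<le> 1 / n + 0"
      using tendsto_le[OF sequentially_bot] by blast
    moreover have "D n x - n * r = n * (D n x / n - r)" using False by (simp add: field_simps)
    ultimately show ?thesis using False by (simp add: abs_mult field_simps)
  qed (simp add: D_def)
  then show ?thesis using that[of r] r by (simp add: D_def)
qed

text \<open>Over \<open>n\<close> applications of \<open>G\<close> the defect grows to
  \<open>n * c\<close>, yet it is a combination of displacements bounded by 2; \<open>n = 3\<close>
  forces the integer \<open>c\<close> to vanish.\<close>

lemma commute_up_to_int_imp_commute:
  fixes F G :: "real \<Rightarrow> real" and c :: int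
  assumes F: "degree_one F" and G: "degree_one G" and comm: "\<And>x. F (G x) = G (F x) + of_int c"
  shows "F (G x) = G (F x)"
proof -
  have pow: "F ((G ^^ n) x) = (G ^^ n) (F x) + of_int (int n * c)" for n x
  proof (induction n)
    case (Suc n)
    have "F ((G ^^ Suc n) x) = G ((G ^^ n) (F x) + of_int (int n * c)) + of_int c"
      using comm Suc by simp
    also have "\<dots> = (G ^^ Suc n) (F x) + of_int (int (Suc n) * c)"
      by (simp only: degree_one_of_int[OF G]) (simp add: algebra_simps)
    finally show ?case .
  qed simp
  have "real n * \<bar>of_int c\<bar> \<le> 2" for n
  proof -
    have "(F ((G ^^ n) x) - (G ^^ n) x) - (F x - x) - (((G ^^ n) (F x) - F x) - ((G ^^ n) x - x))
        = of_int (int n * c)" unfolding pow by simp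
    moreover note degree_one_displacement[OF F, of "(G ^^ n) x" x]
      degree_one_displacement[OF degree_one_funpow[OF G, of n], of "F x" x]
    ultimately have "\<bar>real_of_int (int n * c)\<bar> \<le> 2" by linarith
    then show ?thesis by (simp add: abs_mult)
  qed
  from this[of 3] have "c = 0" by simp
  then show ?thesis using comm by simp
qed

section \<open>Upper limits and the construction of semiconjugacies\<close>

definition upper_limit :: "(nat \<Rightarrow> real) \<Rightarrow> real" where
  "upper_limit u = Inf {c. \<forall>\<^sub>F n in sequentially. u n \<le> c}"

lemma upper_limit_le:
  assumes "Bseq u" "Bseq v" and le: "\<And>n. u (n + i) \<le> v (n + j) + r"
  shows "upper_limit u \<le> upper_limit v + r"
proof -
  let ?S = "\<lambda>w :: nat \<Rightarrow> real. {c. \<forall>\<^sub>F n in sequentially. w n \<le> c}"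
  obtain B where B: "\<And>n. \<bar>u n\<bar> \<le> B" using \<open>Bseq u\<close> by (auto simp: Bseq_def)
  obtain B' where B': "\<And>n. \<bar>v n\<bar> \<le> B'" using \<open>Bseq v\<close> by (auto simp: Bseq_def)
  have "bdd_below (?S u)"
  proof (rule bdd_belowI)
    fix c assume "c \<in> ?S u"
    then obtain n where "u n \<le> c" by (auto simp: eventually_sequentially)
    then show "- B \<le> c" using B[of n] by linarith
  qed
  moreover have "c + r \<in> ?S u" if "c \<in> ?S v" for c
  proof -
    have "\<forall>\<^sub>F n in sequentially. v (n + j) \<le> c"
      using that eventually_sequentially_seg[of "\<lambda>n. v n \<le> c" j] by simp
    then have "\<forall>\<^sub>F n in sequentially. u (n + i) \<le> c + r"
    proof eventually_elim
      case (elim n)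
      then show ?case using le[of n] by linarith
    qed
    then show ?thesis using eventually_sequentially_seg[of "\<lambda>n. u n \<le> c + r" i] by simp
  qed
  ultimately have "upper_limit u - r \<le> c" if "c \<in> ?S v" for c
    using cInf_lower[of "c + r" "?S u"] that unfolding upper_limit_def by fastforce
  moreover have "B' \<in> ?S v" using B' by (auto simp: abs_le_iff)
  ultimately have "upper_limit u - r \<le> upper_limit v"
    unfolding upper_limit_def[of v] by (intro cInf_greatest) auto
  then show ?thesis by simp
qed

text \<open>Replacing \<open>H\<close> by the upper limit of \<open>H (G\<^sup>n x) - n s\<close> makes it equivariant under \<open>G\<close>
  without destroying equivariance under maps that commute with \<open>G\<close>.\<close>

lemma equivariant_extension:
  fixes s :: real
  assumes H: "degree_one H" and G: "degree_one G" and s: "\<And>n x. \<bar>(G ^^ n) x - x - n * s\<bar> \<le> 1"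
  obtains H' where "degree_one H'" "\<And>x. H' (G x) = H' x + s"
    "\<forall>F r. (\<forall>x. F (G x) = G (F x)) \<longrightarrow> (\<forall>x. H (F x) = H x + r) \<longrightarrow> (\<forall>x. H' (F x) = H' x + r)"
proof -
  define u where "u x n = H ((G ^^ n) x) - n * s" for x n
  define H' where "H' x = upper_limit (u x)" for x
  have bdd: "Bseq (u x)" for x
  proof (rule BseqI')
    show "norm (u x n) \<le> \<bar>x\<bar> + \<bar>H 0\<bar> + 2" for n
      using degree_one_displacement[OF H, of "(G ^^ n) x" 0] s[of n x] unfolding u_def by simp
  qed
  \<comment> \<open>Only tails matter, so the indices may be shifted against each other;
    equivariance under \<open>G\<close> is a shift by one.\<close>
  have eq: "H' y = H' x + r" if "\<And>n. u y (n + i) = u x (n + j) + r" for x y r i j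
    using upper_limit_le[OF bdd[of y] bdd[of x], of i j r] upper_limit_le[OF bdd[of x] bdd[of y], of j i "-r"] that
    unfolding H'_def by force
  have "degree_one H'" unfolding degree_one_def
  proof (intro conjI allI monoI)
    show "H' x \<le> H' y" if "x \<le> y" for x y
    proof -
      have "(G ^^ n) x \<le> (G ^^ n) y" for n
        using degree_one_funpow[OF G] that by (auto simp: degree_one_def mono_def)
      then have "u x (n + 0) \<le> u y (n + 0) + 0" for n
        using H unfolding u_def by (auto simp: degree_one_def mono_def)
      from upper_limit_le[OF bdd bdd this] show ?thesis by (simp add: H'_def)
    qed
    show "H' (x + 1) = H' x + 1" for x
      using degree_one_funpow[OF G] H by (intro eq[of _ 0 _ 0]) (simp add: u_def degree_one_def)
  qed
  moreover have "H' (G x) = H' x + s" for x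
    by (rule eq[of _ 0 _ 1]) (simp add: u_def funpow_swap1 algebra_simps)
  moreover have "H' (F x) = H' x + r"
    if comm: "\<And>x. F (G x) = G (F x)" and r: "\<And>x. H (F x) = H x + r" for F r x
  proof -
    have "(G ^^ n) (F x) = F ((G ^^ n) x)" for n by (induction n) (auto simp: comm)
    then show ?thesis using r by (intro eq[of _ 0 _ 0]) (simp add: u_def)
  qed
  ultimately show ?thesis using that by blast
qed

text \<open>Dirichlet approximation gives a small nonzero step \<open>e = k * r - h\<close>. Modulo
  1 the start can be placed at distance less than 2 from the target \<open>]0, |e|]\<close>, so
  about \<open>2 / |e|\<close> steps suffice for every \<open>\<theta>\<close>.\<close>

lemma uniformly_dense_multiples:
  fixes r \<eta> :: real
  assumes irr: "r \<notin> \<rat>" and "\<eta> > 0"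
  obtains K :: nat where "\<And>\<theta>. \<exists>k\<le>K. \<exists>m::int. 0 < \<theta> + k * r + m \<and> \<theta> + k * r + m < \<eta>"
proof -
  obtain N :: nat where N: "N > 0" "1 / real N < \<eta>"
    using \<open>\<eta> > 0\<close> by (metis inverse_eq_divide real_arch_inverse zero_less_iff_neq_zero)
  obtain h k where hk: "0 < k" "\<bar>of_int k * r - of_int h\<bar> < 1 / N" using Dirichlet_approx[OF N(1)] by metis
  define e where "e = of_int k * r - of_int h"
  have "e \<noteq> 0"
  proof
    assume "e = 0"
    then have "r = of_int h / of_int k" using hk(1) by (simp add: e_def field_simps)
    then show False using irr by simp
  qed
  have e: "\<bar>e\<bar> < \<eta>" using hk N by (simp add: e_def)
  define J where "J = nat \<lceil>2 / \<bar>e\<bar>\<rceil> + 1"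
  have "\<exists>k'\<le>nat k * J. \<exists>m::int. 0 < \<theta> + k' * r + m \<and> \<theta> + k' * r + m < \<eta>" for \<theta>
  proof -
    have "\<exists>j\<le>J. \<exists>m::int. 0 < \<theta> + j * e + m \<and> \<theta> + j * e + m \<le> \<bar>e\<bar>"
    proof (cases "e > 0")
      case True
      define t where "t = \<theta> - \<lceil>\<theta>\<rceil>"
      have t: "-1 < t" "t \<le> 0" unfolding t_def by linarith+
      define j where "j = nat (\<lfloor>- t / e\<rfloor> + 1)"
      have "0 \<le> - t / e" using t True by (simp add: divide_nonpos_pos)
      then have "\<lfloor>- t / e\<rfloor> \<ge> 0" by simp
      then have j: "real j = of_int \<lfloor>- t / e\<rfloor> + 1" unfolding j_def by simp
      have "- t / e < real j" "real j \<le> - t / e + 1" unfolding j by linarith+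
      then have "- t < j * e" "j * e \<le> - t + e" using True by (simp_all add: field_simps)
      moreover have "j \<le> J"
      proof -
        have "- t / e \<le> 2 / \<bar>e\<bar>" using True t by (simp add: field_simps)
        then have "\<lfloor>- t / e\<rfloor> \<le> \<lceil>2 / \<bar>e\<bar>\<rceil>" by linarith
        then show ?thesis unfolding j_def J_def using \<open>\<lfloor>- t / e\<rfloor> \<ge> 0\<close> by linarith
      qed
      ultimately show ?thesis using True
        by (intro exI[of _ j] conjI exI[of _ "- \<lceil>\<theta>\<rceil>"]) (auto simp: t_def)
    next
      case False
      with \<open>e \<noteq> 0\<close> have ne: "e < 0" by simp
      \<comment> \<open>A negative step needs a start to the right of the target; the ceiling minus
        1 stops the walk at its last positive position.\<close>
      define t where "t = \<theta> - \<lfloor>\<theta>\<rfloor> + 1"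
      have t: "1 \<le> t" "t < 2" unfolding t_def by linarith+
      define j where "j = nat (\<lceil>t / \<bar>e\<bar>\<rceil> - 1)"
      have "0 < t / \<bar>e\<bar>" using t ne by (intro divide_pos_pos) auto
      then have pos: "\<lceil>t / \<bar>e\<bar>\<rceil> \<ge> 1" by linarith
      then have j: "real j = of_int \<lceil>t / \<bar>e\<bar>\<rceil> - 1" unfolding j_def by simp
      have "real j < t / \<bar>e\<bar>" "t / \<bar>e\<bar> \<le> real j + 1" unfolding j by linarith+
      then have "j * \<bar>e\<bar> < t" "t \<le> j * \<bar>e\<bar> + \<bar>e\<bar>" using ne by (simp_all add: field_simps)
      moreover have "j \<le> J"
      proof -
        have "t / \<bar>e\<bar> \<le> 2 / \<bar>e\<bar>" using t by (simp add: divide_right_mono)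
        then have "\<lceil>t / \<bar>e\<bar>\<rceil> \<le> \<lceil>2 / \<bar>e\<bar>\<rceil>" by (rule ceiling_mono)
        then show ?thesis unfolding j_def J_def by linarith
      qed
      ultimately show ?thesis using ne
        by (intro exI[of _ j] conjI exI[of _ "- \<lfloor>\<theta>\<rfloor> + 1"]) (auto simp: t_def)
    qed
    then obtain j m where j: "j \<le> J" "0 < \<theta> + real j * e + of_int m" "\<theta> + real j * e + of_int m \<le> \<bar>e\<bar>" by auto
    have eq: "\<theta> + (nat k * j) * r + of_int (m - int j * h) = \<theta> + j * e + of_int m"
      using hk(1) by (simp add: e_def algebra_simps)
    show ?thesis
    proof (intro exI conjI)
      show "nat k * j \<le> nat k * J" using j(1) by simp
      show "0 < \<theta> + (nat k * j) * r + of_int (m - int j * h)" unfolding eq by (rule j(2))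
      show "\<theta> + (nat k * j) * r + of_int (m - int j * h) < \<eta>" unfolding eq using j(3) e by linarith
    qed
  qed
  then show ?thesis using that by blast
qed

text \<open>A jump of a monotone function would leave out an open interval of values.\<close>

lemma mono_dense_range_imp_continuous:
  fixes H :: "real \<Rightarrow> real"
  assumes "mono H" and dense: "\<And>t u. t < u \<Longrightarrow> \<exists>x. t < H x \<and> H x < u"
  shows "continuous_on UNIV H"
proof (rule continuous_at_imp_continuous_on, rule ballI)
  fix x
  show "isCont H x" unfolding isCont_def
  proof (rule order_tendstoI)
    fix t assume "t < H x"
    then obtain y where y: "t < H y" "H y < H x" using dense by blast
    then have "y < x" using \<open>mono H\<close> by (metis leD leI monoD)
    moreover have "t < H z" if "z \<in> {y<..}" for z
      using y(1) monoD[OF \<open>mono H\<close>, of y z] that by simp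
    ultimately show "\<forall>\<^sub>F z in at x. t < H z"
      using eventually_at_in_open'[of "{y<..}" x] by (auto elim!: eventually_mono)
  next
    fix t assume "H x < t"
    then obtain y where y: "H x < H y" "H y < t" using dense by blast
    then have "x < y" using \<open>mono H\<close> by (metis leD leI monoD)
    moreover have "H z < t" if "z \<in> {..<y}" for z
      using y(2) monoD[OF \<open>mono H\<close>, of z y] that by simp
    ultimately show "\<forall>\<^sub>F z in at x. H z < t"
      using eventually_at_in_open'[of "{..<y}" x] by (auto elim!: eventually_mono)
  qed
qed

section \<open>Commuting lifts\<close>

text \<open>A common \<open>C\<close> makes the distortion along a path depend on its cost alone.
  The coefficients in \<open>independent\<close> are integers because it is applied to differences
  of exponents.\<close>

locale commuting_lifts =
  fixes d :: nat and \<tau> :: "nat \<Rightarrow> real" and F F' :: "nat \<Rightarrow> real \<Rightarrow> real"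
    and \<rho> :: "nat \<Rightarrow> real" and C :: real
  assumes d_pos: "0 < d"
    and tau_pos: "i < d \<Longrightarrow> 0 < \<tau> i"
    and tau_less: "i < d \<Longrightarrow> \<tau> i < 1"
    and tau_sum: "(\<Sum>i<d. \<tau> i) > 1"
    and F_shift: "i < d \<Longrightarrow> F i (x + 1) = F i x + 1"
    and F_deriv: "i < d \<Longrightarrow> (F i has_real_derivative F' i x) (at x)"
    and F'_pos: "i < d \<Longrightarrow> F' i x > 0"
    and C_nonneg: "C \<ge> 0"
    and distortion: "i < d \<Longrightarrow> ln (F' i x) - ln (F' i y) \<le> C * \<bar>x - y\<bar> powr \<tau> i"
    and F_commute: "i < d \<Longrightarrow> j < d \<Longrightarrow> F i (F j x) = F j (F i x)"
    and translation: "i < d \<Longrightarrow> \<bar>(F i ^^ n) x - x - n * \<rho> i\<bar> \<le> 1"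
    and independent: "(\<Sum>i<d. of_int (z i) * \<rho> i) = of_int m \<Longrightarrow> i < d \<Longrightarrow> z i = (0::int)"
begin

lemma F_strict_mono: "i < d \<Longrightarrow> strict_mono (F i)"
  using DERIV_pos_imp_increasing[of _ _ "F i"] F_deriv F'_pos
  by (metis strict_mono_def)

lemma F_continuous: "i < d \<Longrightarrow> continuous_on S (F i)"
  using F_deriv by (meson DERIV_isCont continuous_at_imp_continuous_on)

lemma F_degree_one: "i < d \<Longrightarrow> degree_one (F i)"
  by (simp add: degree_one_def F_shift F_strict_mono strict_mono_mono)

text \<open>Begin with the identity and make it equivariant under one lift at a time; as the lifts
  commute, earlier equivariance survives.\<close>

lemma semiconjugacy_exists:
  obtains H where "degree_one H" "\<And>i x. i < d \<Longrightarrow> H (F i x) = H x + \<rho> i"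
proof -
  have "\<exists>H. degree_one H \<and> (\<forall>i<k. \<forall>x. H (F i x) = H x + \<rho> i)" if "k \<le> d" for k
    using that
  proof (induction k)
    case 0
    show ?case by (rule exI[of _ "\<lambda>x. x"]) (simp add: degree_one_def mono_def)
  next
    case (Suc k)
    then obtain H where H: "degree_one H" "\<And>i x. i < k \<Longrightarrow> H (F i x) = H x + \<rho> i" by auto
    have k: "k < d" using Suc by simp
    obtain H' where H': "degree_one H'" "\<And>x. H' (F k x) = H' x + \<rho> k"
      "\<forall>G r. (\<forall>x. G (F k x) = F k (G x)) \<longrightarrow> (\<forall>x. H (G x) = H x + r) \<longrightarrow> (\<forall>x. H' (G x) = H' x + r)"
      using equivariant_extension[OF H(1) F_degree_one[OF k] translation[OF k]] by metis
    have "H' (F i x) = H' x + \<rho> i" if "i < k" for i x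
      using H'(3) H(2)[OF that] F_commute[of i k] that k by simp
    with H' show ?case by (metis less_Suc_eq)
  qed
  then show ?thesis using that by blast
qed

lemma rho_0_irrational: "\<rho> 0 \<notin> \<rat>"
proof
  assume "\<rho> 0 \<in> \<rat>"
  then obtain p q :: int where pq: "q > 0" "\<rho> 0 = of_int p / of_int q" by (meson Rats_cases')
  have "(\<Sum>i<d. of_int (if i = 0 then q else 0) * \<rho> i) = of_int q * \<rho> 0"
    using d_pos by (subst sum.remove[of _ 0]) auto
  also have "\<dots> = of_int p" using pq by simp
  finally have "(if (0::nat) = 0 then q else 0) = 0" using d_pos by (rule independent)
  then show False using pq by simp
qed

end

locale semiconjugate_lifts = commuting_lifts +
  fixes H :: "real \<Rightarrow> real"
  assumes H_degree_one: "degree_one H"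
    and H_F: "i < d \<Longrightarrow> H (F i x) = H x + \<rho> i"
begin

lemma H_mono: "x \<le> y \<Longrightarrow> H x \<le> H y"
  using H_degree_one by (auto simp: degree_one_def mono_def)

lemma H_shift: "H (x + of_int k) = H x + of_int k"
  by (rule degree_one_of_int[OF H_degree_one])

text \<open>The range contains all \<open>H 0 + k * \<rho> 0 + m\<close>, a dense set because
  \<open>\<rho> 0\<close> is irrational.\<close>

lemma H_continuous: "continuous_on UNIV H"
proof (rule mono_dense_range_imp_continuous)
  show "mono H" by (simp add: monoI H_mono)
  fix t u :: real assume "t < u"
  then obtain K :: nat where K: "\<And>\<theta>. \<exists>k\<le>K. \<exists>m::int. 0 < \<theta> + k * \<rho> 0 + m \<and> \<theta> + k * \<rho> 0 + m < u - t"
    using uniformly_dense_multiples[OF rho_0_irrational, of "u - t"] by auto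
  then obtain k :: nat and m :: int where
    km: "0 < H 0 - t + k * \<rho> 0 + m" "H 0 - t + k * \<rho> 0 + m < u - t" by blast
  have "H ((F 0 ^^ k) x) = H x + k * \<rho> 0" for x
    by (induction k) (auto simp: H_F d_pos algebra_simps)
  then have "H ((F 0 ^^ k) 0 + of_int m) = H 0 + k * \<rho> 0 + of_int m" by (simp add: H_shift)
  then show "\<exists>x. t < H x \<and> H x < u" using km by (intro exI[of _ "(F 0 ^^ k) 0 + of_int m"]) simp
qed

section \<open>Level sets of the semiconjugacy\<close>

definition level_min :: "real \<Rightarrow> real" where "level_min t = Inf (H -` {t})"

definition level_max :: "real \<Rightarrow> real" where "level_max t = Sup (H -` {t})"

lemma level_bounds:
  assumes "H x = t"
  shows "t - H 0 - 1 \<le> x" "x \<le> t - H 0 + 1"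
  using degree_one_displacement[OF H_degree_one, of x 0] assms by simp_all

lemma level_bdd: "bdd_below (H -` {t})" "bdd_above (H -` {t})"
  using level_bounds by (auto intro!: bdd_belowI[of _ "t - H 0 - 1"] bdd_aboveI[of _ "t - H 0 + 1"] simp del: of_int_add)

lemma level_closed: "closed (H -` {t})"
  using H_continuous by (intro closed_vimage) auto

lemma H_level_min: "H (level_min t) = t" and H_level_max: "H (level_max t) = t"
proof -
  have ne: "H -` {t} \<noteq> {}" using degree_one_surj[OF H_degree_one H_continuous] by (metis empty_iff surjD vimage_singleton_eq)
  show "H (level_min t) = t" "H (level_max t) = t"
    using closed_contains_Inf[OF ne level_bdd(1) level_closed] closed_contains_Sup[OF ne level_bdd(2) level_closed]
    by (simp_all add: level_min_def level_max_def)
qed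

lemma level_minI: "H x = t \<Longrightarrow> level_min t \<le> x" and level_maxI: "H x = t \<Longrightarrow> x \<le> level_max t"
  using level_bdd by (auto simp: level_min_def level_max_def intro: cInf_lower cSup_upper)

lemma level_min_le_max: "level_min t \<le> level_max t"
  by (simp add: H_level_max level_minI)

lemma level_max_less_min:
  assumes "t < u"
  shows "level_max t < level_min u"
proof (rule ccontr)
  assume "\<not> ?thesis"
  then have "u \<le> t" using H_mono[of "level_min u" "level_max t"] by (simp add: H_level_min H_level_max)
  with assms show False by simp
qed

text \<open>Every symmetry of \<open>H\<close> permutes the level sets, hence their endpoints.\<close>

lemma level_equivariant:
  assumes g: "strict_mono g" "surj g" and eq: "\<And>x. H (g x) = H x + r"
  shows "level_min (t + r) = g (level_min t)" "level_max (t + r) = g (level_max t)"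
proof -
  obtain w where w: "g w = level_min (t + r)" using g(2) by (metis surjD)
  have "H w = t" using eq[of w] by (simp add: w H_level_min)
  then have "g (level_min t) \<le> level_min (t + r)"
    using level_minI g(1) by (metis strict_mono_less_eq w)
  moreover have "level_min (t + r) \<le> g (level_min t)" by (rule level_minI) (simp add: eq H_level_min)
  ultimately show "level_min (t + r) = g (level_min t)" by simp
  obtain w where w: "g w = level_max (t + r)" using g(2) by (metis surjD)
  have "H w = t" using eq[of w] by (simp add: w H_level_max)
  then have "level_max (t + r) \<le> g (level_max t)"
    using level_maxI g(1) by (metis strict_mono_less_eq w)
  moreover have "g (level_max t) \<le> level_max (t + r)" by (rule level_maxI) (simp add: eq H_level_max)
  ultimately show "level_max (t + r) = g (level_max t)" by simp
qed

lemma level_F: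
  assumes "i < d"
  shows "level_min (t + \<rho> i) = F i (level_min t)" "level_max (t + \<rho> i) = F i (level_max t)"
  using level_equivariant[OF F_strict_mono[OF assms] degree_one_surj[OF F_degree_one[OF assms] F_continuous[OF assms]] H_F[OF assms]] by auto

lemma level_shift:
  shows "level_min (t + of_int m) = level_min t + of_int m" "level_max (t + of_int m) = level_max t + of_int m"
proof -
  have "strict_mono (\<lambda>x. x + real_of_int m)" by (simp add: strict_mono_def)
  moreover have "surj (\<lambda>x. x + real_of_int m)" by (rule surjI[of _ "\<lambda>x. x - real_of_int m"]) simp
  ultimately show "level_min (t + of_int m) = level_min t + of_int m" "level_max (t + of_int m) = level_max t + of_int m"
    using level_equivariant[of "\<lambda>x. x + of_int m" "of_int m" t] H_shift by auto
qed

definition gap :: "real \<Rightarrow> real" where "gap t = level_max t - level_min t"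

lemma gap_nonneg: "gap t \<ge> 0"
  by (simp add: gap_def level_min_le_max)

lemma gap_frac: "gap (frac t) = gap t"
  using level_shift[of t "- \<lfloor>t\<rfloor>"] by (simp add: gap_def frac_def)

text \<open>Level intervals are disjoint and ordered like their heights. Heights are added in
  increasing order, and the intervals added so far end before \<open>level_min u\<close>.\<close>

lemma sum_gaps_le:
  assumes "finite Q" "\<And>t. t \<in> Q \<Longrightarrow> 0 \<le> t \<and> t < u" "0 \<le> u"
  shows "sum gap Q \<le> level_min u - level_min 0"
  using assms
proof (induction Q arbitrary: u rule: finite_linorder_max_induct)
  case empty
  have "level_min 0 \<le> level_min u"
    using level_max_less_min[of 0 u] level_min_le_max[of 0] empty by (cases "u = 0") auto
  then show ?case by simp
next
  case (insert b A)
  have "sum gap A \<le> level_min b - level_min 0" using insert by (intro insert.IH) auto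
  moreover have "level_max b \<le> level_min u" using level_max_less_min[of b u] insert.prems by auto
  moreover have "b \<notin> A" using insert.hyps by auto
  ultimately show ?case using insert.hyps by (simp add: gap_def)
qed

section \<open>Gaps along an orbit and their absence\<close>

definition shift_by :: "(nat \<Rightarrow> nat) \<Rightarrow> real" where
  "shift_by n = (\<Sum>i<d. n i * \<rho> i)"

lemma shift_by_add:
  assumes "i < d"
  shows "shift_by (n(i := n i + k)) = shift_by n + k * \<rho> i"
proof -
  have "shift_by m = m i * \<rho> i + (\<Sum>j\<in>{..<d} - {i}. m j * \<rho> j)" for m :: "nat \<Rightarrow> nat"
    unfolding shift_by_def using assms by (subst sum.remove[of _ i]) auto
  then show ?thesis by (simp add: algebra_simps)
qed

text \<open>Two points with equal heights modulo 1 would give an integer relation between the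
  \<open>\<rho> i\<close>, so their exponents agree and, being extensional, they coincide. Modulo 1
  the gaps are thus disjoint intervals in one period.\<close>

lemma gap_sum_orbit:
  assumes "finite Y" "Y \<subseteq> PiE {..<d} (\<lambda>_. UNIV)"
  shows "(\<Sum>n\<in>Y. gap (c + shift_by n)) \<le> 1"
proof -
  let ?t = "\<lambda>n. frac (c + shift_by n)"
  have "inj_on ?t Y"
  proof (rule inj_onI)
    fix n n' assume Y: "n \<in> Y" "n' \<in> Y" and eq: "?t n = ?t n'"
    have "(\<Sum>i<d. of_int (int (n i) - int (n' i)) * \<rho> i) = shift_by n - shift_by n'"
      by (simp add: shift_by_def sum_subtractf algebra_simps)
    also have "\<dots> = of_int (\<lfloor>c + shift_by n\<rfloor> - \<lfloor>c + shift_by n'\<rfloor>)" using eq by (simp add: frac_def)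
    finally have "int (n i) - int (n' i) = 0" if "i < d" for i using that by (rule independent)
    then have "n i = n' i" if "i < d" for i using that by fastforce
    then show "n = n'" using Y assms(2) by (intro PiE_ext[of n "{..<d}" "\<lambda>_. UNIV" n']) auto
  qed
  then have "(\<Sum>n\<in>Y. gap (c + shift_by n)) = sum gap (?t ` Y)"
    by (subst sum.reindex) (auto simp: gap_frac)
  also have "\<dots> \<le> level_min 1 - level_min 0"
    using assms(1) by (intro sum_gaps_le) (auto simp: frac_lt_1)
  also have "\<dots> = 1" using level_shift(1)[of 0 1] by simp
  finally show ?thesis .
qed

text \<open>The gap of height \<open>c\<close> and an interval to its right have images of comparable length, with
  a ratio that is controlled by the cost of the path alone; \<open>\<delta>\<close> is so small that the ratio stays
  below 1, which is what the induction needs to go on.\<close>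

lemma path_distortion:
  fixes c S :: real
  defines "\<delta> \<equiv> gap c * exp (- 2 * C * S)"
  assumes pos: "gap c > 0"
    and path: "path_cost d (\<lambda>n. gap (c + shift_by n)) \<tau> n s" and "s \<le> S"
  shows "\<exists>h. continuous_on UNIV h \<and> strict_mono h \<and> (\<forall>x. H (h x) = H x + shift_by n) \<and>
    h (level_min c) = level_min (c + shift_by n) \<and> h (level_max c) = level_max (c + shift_by n) \<and>
    h (level_max c + \<delta>) - h (level_max c) \<le> exp (- 2 * C * (S - s)) * gap (c + shift_by n)"
  using path \<open>s \<le> S\<close>
proof (induction rule: path_cost.induct)
  case start
  have "shift_by (\<lambda>i\<in>{..<d}. 0) = 0" by (simp add: shift_by_def)
  then show ?case
    unfolding \<delta>_def by (intro exI[of _ "\<lambda>x. x"]) (simp only: strict_mono_def, simp)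
next
  case (step n s i)
  let ?g = "gap (c + shift_by n)"
  have i: "i < d" by fact
  have "0 \<le> ?g powr \<tau> i" by simp
  with step.prems have "s \<le> S" by linarith
  from step.IH[OF this] obtain h where h: "continuous_on UNIV h" "strict_mono h"
    "\<And>x. H (h x) = H x + shift_by n"
    "h (level_min c) = level_min (c + shift_by n)" "h (level_max c) = level_max (c + shift_by n)"
    "h (level_max c + \<delta>) - h (level_max c) \<le> exp (- 2 * C * (S - s)) * ?g" by blast
  define u v w where "u = h (level_min c)" and "v = h (level_max c)" and "w = h (level_max c + \<delta>)"
  have "\<delta> > 0" using pos by (simp add: \<delta>_def)
  then have uvw: "u < v" "v < w"
    using h(2) pos by (simp_all add: u_def v_def w_def strict_mono_less gap_def)
  have g: "?g = v - u" using h by (simp add: u_def v_def gap_def)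
  have "- 2 * C * (S - s) \<le> 0" using C_nonneg \<open>s \<le> S\<close> by (simp add: mult_nonneg_nonneg)
  then have "exp (- 2 * C * (S - s)) \<le> 1" by simp
  then have "exp (- 2 * C * (S - s)) * (v - u) \<le> 1 * (v - u)" using uvw by (intro mult_right_mono) auto
  moreover have wv: "w - v \<le> exp (- 2 * C * (S - s)) * (v - u)" using h(6) unfolding g by (simp add: v_def w_def)
  ultimately have wv1: "w - v \<le> v - u" by simp
  obtain \<xi> where \<xi>: "u < \<xi>" "\<xi> < v" "F i v - F i u = (v - u) * F' i \<xi>"
    using MVT2[OF uvw(1), of "F i" "F' i"] F_deriv[OF i] by auto
  obtain \<zeta> where \<zeta>: "v < \<zeta>" "\<zeta> < w" "F i w - F i v = (w - v) * F' i \<zeta>"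
    using MVT2[OF uvw(2), of "F i" "F' i"] F_deriv[OF i] by auto
  \<comment> \<open>Both mean value points lie in \<open>]u, w[\<close>, at most twice as long as
    the gap image \<open>]u, v[\<close>; hence the factor 2 in the exponent of
    \<open>\<delta>\<close>.\<close>
  have "\<bar>\<zeta> - \<xi>\<bar> powr \<tau> i \<le> (2 * (v - u)) powr \<tau> i"
    using \<xi> \<zeta> wv1 tau_pos[OF i] by (intro powr_mono2) auto
  also have "\<dots> = 2 powr \<tau> i * (v - u) powr \<tau> i" by (rule powr_mult)
  also have "\<dots> \<le> 2 * (v - u) powr \<tau> i"
    using tau_less[OF i] powr_mono[of "\<tau> i" 1 2] by (intro mult_right_mono) auto
  finally have "C * \<bar>\<zeta> - \<xi>\<bar> powr \<tau> i \<le> C * (2 * (v - u) powr \<tau> i)" using C_nonneg by (intro mult_left_mono)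
  with distortion[OF i, of \<zeta> \<xi>] have "ln (F' i \<zeta>) \<le> ln (F' i \<xi>) + 2 * C * ?g powr \<tau> i" unfolding g by simp
  then have "exp (ln (F' i \<zeta>)) \<le> exp (ln (F' i \<xi>) + 2 * C * ?g powr \<tau> i)" by simp
  then have F': "F' i \<zeta> \<le> F' i \<xi> * exp (2 * C * ?g powr \<tau> i)" using F'_pos[OF i] by (simp add: exp_add)
  \<comment> \<open>The distortion of the step uses up exactly the part of the budget
    \<open>S - s\<close> that the step costs.\<close>
  have "F i w - F i v \<le> (exp (- 2 * C * (S - s)) * (v - u)) * (F' i \<xi> * exp (2 * C * ?g powr \<tau> i))"
    unfolding \<zeta>(3) using wv F' uvw F'_pos[OF i, of \<zeta>] by (intro mult_mono) auto
  also have "\<dots> = exp (- 2 * C * (S - s)) * exp (2 * C * ?g powr \<tau> i) * (F i v - F i u)"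
    unfolding \<xi>(3) by simp
  also have "exp (- 2 * C * (S - s)) * exp (2 * C * ?g powr \<tau> i) = exp (- 2 * C * (S - (s + ?g powr \<tau> i)))"
    by (simp add: exp_add[symmetric] algebra_simps)
  finally have est: "F i w - F i v \<le> exp (- 2 * C * (S - (s + ?g powr \<tau> i))) * (F i v - F i u)" .
  have sh: "shift_by (n(i := Suc (n i))) = shift_by n + \<rho> i"
    using shift_by_add[OF i, of n 1] by simp
  have ends: "F i u = level_min (c + shift_by (n(i := Suc (n i))))" "F i v = level_max (c + shift_by (n(i := Suc (n i))))"
    unfolding sh using level_F[OF i, of "c + shift_by n"] h(4,5) by (simp_all add: u_def v_def add.assoc)
  show ?case
  proof (intro exI[of _ "\<lambda>x. F i (h x)"] conjI allI)
    show "continuous_on UNIV (\<lambda>x. F i (h x))"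
      using continuous_on_compose[OF h(1) F_continuous[OF i]] by (simp add: o_def)
    show "strict_mono (\<lambda>x. F i (h x))" using h(2) F_strict_mono[OF i] by (simp add: strict_mono_def)
    show "H (F i (h x)) = H x + shift_by (n(i := Suc (n i)))" for x
      by (simp add: H_F[OF i] h(3) sh)
    show "F i (h (level_max c + \<delta>)) - F i (h (level_max c))
      \<le> exp (- 2 * C * (S - (s + ?g powr \<tau> i))) * gap (c + shift_by (n(i := Suc (n i))))"
      using est ends by (simp add: gap_def u_def v_def w_def)
  qed (use ends in \<open>simp_all only: u_def v_def\<close>)
qed

lemma gap_eq_0: "gap c = 0"
proof (rule ccontr)
  assume "gap c \<noteq> 0"
  then have pos: "gap c > 0" using gap_nonneg[of c] by simp
  interpret summable_weights d "\<lambda>n. gap (c + shift_by n)" \<tau>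
    by unfold_locales (use d_pos gap_nonneg gap_sum_orbit tau_pos tau_less tau_sum in auto)
  obtain S where S: "\<And>K. \<exists>p. \<forall>k\<le>K. \<exists>s\<le>S. path_cost d (\<lambda>n. gap (c + shift_by n)) \<tau> (p(0 := p 0 + k)) s"
    using bounded_cost_reachable_lines by blast
  define \<delta> where "\<delta> = gap c * exp (- 2 * C * S)"
  have \<delta>: "\<delta> > 0" using pos by (simp add: \<delta>_def)
  define b where "b = level_max c"
  \<comment> \<open>Levels with height strictly between \<open>c\<close> and
    \<open>c + \<eta>\<close> lie within \<open>\<delta> / 2\<close> to the right of the
    gap.\<close>
  define \<eta> where "\<eta> = H (b + \<delta> / 2) - c"
  have "H (b + \<delta> / 2) \<noteq> c" using level_maxI[of "b + \<delta> / 2" c] \<delta> by (auto simp: b_def)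
  moreover have "H (b + \<delta> / 2) \<ge> c" using H_mono[of b "b + \<delta> / 2"] \<delta> by (simp add: b_def H_level_max)
  ultimately have "\<eta> > 0" by (simp add: \<eta>_def)
  \<comment> \<open>\<open>K\<close> depends on \<open>\<eta>\<close> only and is fixed before the
    path; the position on its final segment then compensates for the unknown
    \<open>shift_by p\<close>.\<close>
  then obtain K :: nat where K: "\<And>\<theta>. \<exists>k\<le>K. \<exists>m::int. 0 < \<theta> + k * \<rho> 0 + m \<and> \<theta> + k * \<rho> 0 + m < \<eta>"
    using uniformly_dense_multiples[OF rho_0_irrational] by blast
  obtain p where p: "\<And>k. k \<le> K \<Longrightarrow> \<exists>s\<le>S. path_cost d (\<lambda>n. gap (c + shift_by n)) \<tau> (p(0 := p 0 + k)) s"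
    using S by blast
  obtain k :: nat and m :: int where km: "k \<le> K" "0 < shift_by p + k * \<rho> 0 + m" "shift_by p + k * \<rho> 0 + m < \<eta>"
    using K by blast
  define n where "n = p(0 := p 0 + k)"
  have n: "shift_by n = shift_by p + k * \<rho> 0" unfolding n_def by (rule shift_by_add[OF d_pos])
  obtain s where s: "s \<le> S" "path_cost d (\<lambda>n. gap (c + shift_by n)) \<tau> n s" using p[OF km(1)] unfolding n_def by blast
  obtain h where h: "continuous_on UNIV h" "strict_mono h" "\<And>x. H (h x) = H x + shift_by n"
    "h (level_max c) = level_max (c + shift_by n)"
    "h (level_max c + \<delta>) - h (level_max c) \<le> exp (- 2 * C * (S - s)) * gap (c + shift_by n)"
    using path_distortion[OF pos s(2,1)] unfolding \<delta>_def by blast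
  define t where "t = c + shift_by n + of_int m"
  have t: "c < t" "t < H (b + \<delta> / 2)" using km(2,3) by (simp_all add: t_def n \<eta>_def)
  have lo: "b < level_min t" unfolding b_def by (rule level_max_less_min[OF t(1)])
  have hi: "level_max t < b + \<delta> / 2"
  proof (rule ccontr)
    assume "\<not> ?thesis"
    then have "H (b + \<delta> / 2) \<le> t" using H_mono[of "b + \<delta> / 2" "level_max t"] by (simp add: H_level_max)
    with t show False by simp
  qed
  have hb: "h b + of_int m = level_max t" using h(4) by (simp add: b_def t_def level_shift)
  have "- 2 * C * (S - s) \<le> 0" using C_nonneg \<open>s \<le> S\<close> by (simp add: mult_nonneg_nonneg)
  then have "exp (- 2 * C * (S - s)) \<le> 1" by simp
  then have "exp (- 2 * C * (S - s)) * gap (c + shift_by n) \<le> 1 * gap (c + shift_by n)"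
    using gap_nonneg by (intro mult_right_mono) auto
  also have "\<dots> = gap t" by (simp add: t_def gap_def level_shift)
  finally have "h (b + \<delta>) - h b \<le> gap t" using h(5) by (simp add: b_def)
  \<comment> \<open>The level interval of \<open>t\<close> lies in
    \<open>]b, b + \<delta> / 2[\<close>. The image of \<open>[b, b + \<delta>]\<close> under
    \<open>h\<close> followed by the shift by \<open>m\<close> starts at \<open>level_max t\<close>
    and is at most as long as that interval, so it ends before \<open>b + \<delta>\<close>.\<close>
  then have down: "h (b + \<delta>) + of_int m < b + \<delta>" using lo hi hb by (simp add: gap_def)
  have up: "b < h b + of_int m" using hb lo level_min_le_max[of t] by simp
  have "\<exists>x\<ge>b. x \<le> b + \<delta> \<and> h x + of_int m - x = 0"
  proof (rule IVT2')
    show "continuous_on {b..b + \<delta>} (\<lambda>x. h x + of_int m - x)"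
      by (intro continuous_intros continuous_on_subset[OF h(1)]) auto
  qed (use up down \<delta> in auto)
  then obtain x where "h x + of_int m = x" by auto
  \<comment> \<open>Under this map \<open>H\<close> grows by \<open>t - c > 0\<close>, which
    excludes a fixed point.\<close>
  then have "H x = H (h x + of_int m)" by simp
  also have "\<dots> = H x + shift_by n + of_int m" by (simp only: H_shift h(3))
  finally show False using t(1) by (simp add: t_def)
qed

lemma H_strict_mono: "strict_mono H"
proof (rule strict_monoI)
  fix x y :: real assume "x < y"
  have "H x \<noteq> H y"
  proof
    assume "H x = H y"
    then have "gap (H x) \<ge> y - x" using level_minI[of x "H x"] level_maxI[of y "H x"] by (simp add: gap_def)
    with \<open>x < y\<close> show False by (simp add: gap_eq_0)
  qed
  with H_mono[of x y] \<open>x < y\<close> show "H x < H y" by simp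
qed

end

section \<open>Passing between the circle and the line\<close>

lemma cis_2pi_eq_iff: "cis (2 * pi * x) = cis (2 * pi * y) \<longleftrightarrow> (\<exists>k::int. x = y + of_int k)"
proof -
  have "cis (2 * pi * x) = cis (2 * pi * y) \<longleftrightarrow> (\<exists>k::int. 2 * pi * x = 2 * pi * y + 2 * pi * of_int k)"
    using sin_cos_eq_iff[of "2 * pi * x" "2 * pi * y"] by (auto simp: complex_eq_iff)
  also have "\<dots> \<longleftrightarrow> (\<exists>k::int. x = y + of_int k)"
    by (simp flip: distrib_left)
  finally show ?thesis .
qed

lemma S1_cis:
  assumes "z \<in> S1"
  obtains x where "0 \<le> x" "x \<le> 1" "z = cis (2 * pi * x)"
proof -
  have "z = cis (Arg2pi z)" using assms Arg2pi_eq[of z] by (simp add: cis_conv_exp)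
  then show ?thesis using that[of "Arg2pi z / (2 * pi)"] Arg2pi_ge_0[of z] Arg2pi_lt_2pi[of z] by simp
qed

lemma lifts_differ_by_int:
  fixes F G :: "real \<Rightarrow> real"
  assumes "continuous_on UNIV F" "continuous_on UNIV G"
    and eq: "\<And>x. cis (2 * pi * F x) = cis (2 * pi * G x)"
  obtains k :: int where "\<And>x. F x = G x + of_int k"
proof -
  have int: "F x - G x \<in> \<int>" for x
    using eq[of x] unfolding cis_2pi_eq_iff by auto
  have "(\<lambda>x. F x - G x) constant_on UNIV"
  proof (rule continuous_discrete_range_constant)
    show "continuous_on UNIV (\<lambda>x. F x - G x)" using assms by (intro continuous_intros)
    show "\<exists>e>0. \<forall>y. y \<in> UNIV \<and> F y - G y \<noteq> F x - G x \<longrightarrow> e \<le> norm (F y - G y - (F x - G x))" for x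
    proof (intro exI[of _ 1] conjI allI impI)
      fix y assume "y \<in> UNIV \<and> F y - G y \<noteq> F x - G x"
      then show "1 \<le> norm (F y - G y - (F x - G x))"
        using Ints_nonzero_abs_ge1[OF Ints_diff[OF int int]] by simp
    qed auto
  qed auto
  then obtain c where c: "\<And>x. F x - G x = c" by (auto simp: constant_on_def)
  then obtain k :: int where "c = of_int k" using int[of 0] by (metis Ints_cases)
  then show ?thesis using that[of k] c by (simp add: algebra_simps)
qed

lemma homeomorphism_of_lift:
  assumes H: "degree_one H" "strict_mono H" and cont: "continuous_on UNIV H"
  obtains \<phi> \<psi> where "homeomorphism S1 S1 \<phi> \<psi>" "\<And>x. \<phi> (cis (2 * pi * x)) = cis (2 * pi * H x)"
proof -
  define \<phi> where "\<phi> z = cis (2 * pi * H (Arg z / (2 * pi)))" for z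
  have \<phi>: "\<phi> (cis (2 * pi * x)) = cis (2 * pi * H x)" for x
  proof -
    let ?y = "Arg (cis (2 * pi * x)) / (2 * pi)"
    have "cis (2 * pi * ?y) = cis (2 * pi * x)" using cis_Arg[of "cis (2 * pi * x)"] by (simp add: sgn_div_norm)
    then obtain k :: int where "?y = x + of_int k" unfolding cis_2pi_eq_iff by auto
    then have "H ?y = H x + of_int k" by (simp only: degree_one_of_int[OF H(1)])
    then show ?thesis unfolding \<phi>_def cis_2pi_eq_iff by auto
  qed
  \<comment> \<open>The formula for \<open>\<phi>\<close> contains the jump of \<open>Arg\<close>,
    so continuity comes from compactness: the preimage of a closed set is the image of a compact
    subset of \<open>{0..1}\<close>.\<close>
  have "continuous_on S1 \<phi>"
  proof (subst continuous_on_closed_vimage)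
    show "\<forall>B. closed B \<longrightarrow> closed (\<phi> -` B \<inter> S1)"
    proof (intro allI impI)
      fix B :: "complex set" assume B: "closed B"
      let ?K = "{0..1} \<inter> (\<lambda>x. cis (2 * pi * H x)) -` B"
      have "\<phi> -` B \<inter> S1 = (\<lambda>x. cis (2 * pi * x)) ` ?K"
      proof
        show "\<phi> -` B \<inter> S1 \<subseteq> (\<lambda>x. cis (2 * pi * x)) ` ?K"
        proof
          fix z assume z: "z \<in> \<phi> -` B \<inter> S1"
          then obtain x where "0 \<le> x" "x \<le> 1" "z = cis (2 * pi * x)" using S1_cis by blast
          then show "z \<in> (\<lambda>x. cis (2 * pi * x)) ` ?K" using z \<phi> by auto
        qed
      qed (auto simp: \<phi>)
      moreover have "compact ?K"
      proof (rule compact_Int_closed)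
        show "closed ((\<lambda>x. cis (2 * pi * H x)) -` B)"
          using B cont by (intro closed_vimage continuous_on_cis continuous_intros) auto
      qed auto
      then have "compact ((\<lambda>x. cis (2 * pi * x)) ` ?K)"
        by (intro compact_continuous_image continuous_on_cis continuous_intros)
      ultimately show "closed (\<phi> -` B \<inter> S1)" by (simp add: compact_imp_closed)
    qed
  qed auto
  moreover have "inj_on \<phi> S1"
  proof (rule inj_onI)
    fix z w assume zw: "z \<in> S1" "w \<in> S1" "\<phi> z = \<phi> w"
    obtain x y where xy: "z = cis (2 * pi * x)" "w = cis (2 * pi * y)" using S1_cis zw(1,2) by metis
    obtain k :: int where "H x = H y + of_int k" using zw(3) unfolding xy \<phi> cis_2pi_eq_iff by auto
    then have "H x = H (y + of_int k)" by (simp only: degree_one_of_int[OF H(1)])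
    then have "x = y + of_int k" using H(2) by (simp add: strict_mono_eq)
    then show "z = w" unfolding xy cis_2pi_eq_iff by blast
  qed
  moreover have "\<phi> ` S1 = S1"
  proof
    show "S1 \<subseteq> \<phi> ` S1"
    proof
      fix z assume "z \<in> S1"
      then obtain y where y: "z = cis (2 * pi * y)" using S1_cis by metis
      obtain x where "y = H x" using degree_one_surj[OF H(1) cont] by (metis surjD)
      then have "z = \<phi> (cis (2 * pi * x))" by (simp add: y \<phi>)
      then show "z \<in> \<phi> ` S1" by (rule image_eqI) simp
    qed
  qed (auto simp: \<phi>_def)
  ultimately obtain \<psi> where "homeomorphism S1 S1 \<phi> \<psi>" using homeomorphism_compact[of S1 \<phi> S1] by auto
  then show ?thesis using that \<phi> by blast
qed

text \<open>The derivative is periodic, so compactness gives a positive lower bound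
  \<open>\<mu>\<close>; by \<open>ln t \<le> t - 1\<close> the Hoelder constant is only divided by
  \<open>\<mu>\<close>.\<close>

lemma log_derivative_Hoelder:
  assumes shift: "\<And>x. F (x + 1) = F x + (1::real)"
    and deriv: "\<And>x. (F has_real_derivative F' x) (at x)"
    and cont: "continuous_on UNIV F'" and pos: "\<And>x. F' x > 0"
    and Hoelder: "\<And>x y. \<bar>F' x - F' y\<bar> \<le> C * \<bar>x - y\<bar> powr t"
  obtains D where "D \<ge> 0" "\<And>x y. ln (F' x) - ln (F' y) \<le> D * \<bar>x - y\<bar> powr t"
proof -
  have per: "F' (x + 1) = F' x" for x
  proof (rule DERIV_unique)
    have "((\<lambda>y. F (y + 1)) has_real_derivative F' (x + 1) * 1) (at x)"
      by (rule DERIV_chain2[OF deriv]) (auto intro!: derivative_eq_intros)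
    then have "((\<lambda>y. F y + 1) has_real_derivative F' (x + 1)) (at x)" by (simp add: shift)
    from DERIV_diff[OF this DERIV_const[of 1]] show "(F has_real_derivative F' (x + 1)) (at x)" by simp
  qed (rule deriv)
  have "continuous_on {0..1} F'" by (rule continuous_on_subset[OF cont]) simp
  then obtain x0 where x0: "\<forall>x\<in>{0..1}. F' x0 \<le> F' x"
    using continuous_attains_inf[of "{0..1}" F'] by auto
  define \<mu> where "\<mu> = F' x0"
  have \<mu>: "\<mu> > 0" by (simp add: \<mu>_def pos)
  have lower: "\<mu> \<le> F' x" for x
  proof -
    \<comment> \<open>Adding \<open>x\<close> turns the periodic \<open>F'\<close> into a map to
      which \<open>shift_of_int\<close> applies.\<close>
    have "F' x = F' (frac x)"
      using shift_of_int[of "\<lambda>x. F' x + x" "frac x" "\<lfloor>x\<rfloor>"] per by (simp add: frac_def)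
    then show ?thesis using bspec[OF x0, of "frac x"] by (simp add: \<mu>_def frac_lt_1 less_imp_le)
  qed
  have C: "C \<ge> 0" using Hoelder[of 0 1] by simp
  have "ln (F' x) - ln (F' y) \<le> C / \<mu> * \<bar>x - y\<bar> powr t" for x y
  proof -
    have "ln (F' x) - ln (F' y) = ln (F' x / F' y)" using pos[of x] pos[of y] by (simp add: ln_div)
    also have "\<dots> \<le> F' x / F' y - 1" using pos by (intro ln_le_minus_one) simp
    also have "\<dots> = (F' x - F' y) / F' y" using pos[of y] by (simp add: field_simps)
    also have "\<dots> \<le> \<bar>F' x - F' y\<bar> / \<mu>" using lower[of y] \<mu> by (intro frac_le) auto
    also have "\<dots> \<le> C * \<bar>x - y\<bar> powr t / \<mu>" using Hoelder \<mu> by (intro divide_right_mono) auto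
    finally show ?thesis by simp
  qed
  then show ?thesis using that[of "C / \<mu>"] C \<mu> by simp
qed

text \<open>The rotation number is computed from the lift chosen by \<open>SOME\<close>, while
  smoothness is given for a possibly different one; they differ by an integer constant and share
  their derivative.\<close>

lemma circle_diffeo_lift:
  assumes "circle_diffeo_C1tau t f"
  obtains F F' D where "is_lift f F" "F = (SOME F. is_lift f F)" "\<And>x. (F has_real_derivative F' x) (at x)"
    "\<And>x. F' x > 0" "D \<ge> 0" "\<And>x y. ln (F' x) - ln (F' y) \<le> D * \<bar>x - y\<bar> powr t"
proof -
  from assms obtain F F' C where F: "is_lift f F" "\<And>x. (F has_real_derivative F' x) (at x)"
    "continuous_on UNIV F'" "\<And>x. F' x > 0" "\<And>x y. \<bar>F' x - F' y\<bar> \<le> C * \<bar>x - y\<bar> powr t"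
    unfolding circle_diffeo_C1tau_def by blast
  define G where "G = (SOME F. is_lift f F)"
  have G: "is_lift f G" unfolding G_def using someI[of "is_lift f" F] F(1) by simp
  obtain k :: int where k: "\<And>x. G x = F x + of_int k"
    using lifts_differ_by_int[of G F] F(1) G unfolding is_lift_def by metis
  then have "G = (\<lambda>x. F x + of_int k)" by auto
  then have dG: "(G has_real_derivative F' x) (at x)" for x
    using DERIV_add[OF F(2) DERIV_const] by simp
  have sh: "G (x + 1) = G x + 1" for x using G by (simp add: is_lift_def)
  obtain D where "D \<ge> 0" "\<And>x y. ln (F' x) - ln (F' y) \<le> D * \<bar>x - y\<bar> powr t"
    using log_derivative_Hoelder[OF sh dG F(3,4,5)] by metis
  then show ?thesis using that[OF G G_def dG F(4)] by blast
qed

section \<open>Reduction of the theorem to commuting lifts\<close>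

theorem theoremA:
  fixes d :: nat and \<tau> :: "nat \<Rightarrow> real" and f :: "nat \<Rightarrow> complex \<Rightarrow> complex"
  assumes "d \<ge> 2"
    and "\<forall>k<d. 0 < \<tau> k \<and> \<tau> k < 1"
    and "(\<Sum>k<d. \<tau> k) > 1"
    and "\<forall>k<d. circle_diffeo_C1tau (\<tau> k) (f k)"
    and "\<forall>j<d. \<forall>k<d. \<forall>z\<in>S1. f j (f k z) = f k (f j z)"
    and "rat_independent d (\<lambda>k. rot_num (f k))"
  shows "\<exists>\<phi> \<psi>. homeomorphism S1 S1 \<phi> \<psi> \<and>
           (\<forall>k<d. \<exists>\<alpha>::real. \<forall>z\<in>S1. \<phi> (f k (\<psi> z)) = cis \<alpha> * z)"
proof -
  define F where "F k = (SOME F. is_lift (f k) F)" for k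
  have "\<forall>k. \<exists>F' D. k < d \<longrightarrow> is_lift (f k) (F k) \<and> (\<forall>x. (F k has_real_derivative F' x) (at x)) \<and>
    (\<forall>x. F' x > 0) \<and> D \<ge> 0 \<and> (\<forall>x y. ln (F' x) - ln (F' y) \<le> D * \<bar>x - y\<bar> powr \<tau> k)"
    using assms(4) circle_diffeo_lift unfolding F_def by metis
  then obtain F' D where lift: "\<And>k. k < d \<Longrightarrow> is_lift (f k) (F k)"
    and deriv: "\<And>k x. k < d \<Longrightarrow> (F k has_real_derivative F' k x) (at x)"
    and pos: "\<And>k x. k < d \<Longrightarrow> F' k x > 0" and D: "\<And>k. k < d \<Longrightarrow> D k \<ge> 0"
    and dist: "\<And>k x y. k < d \<Longrightarrow> ln (F' k x) - ln (F' k y) \<le> D k * \<bar>x - y\<bar> powr \<tau> k" by metis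
  have shift: "F k (x + 1) = F k x + 1" and cis: "f k (cis (2 * pi * x)) = cis (2 * pi * F k x)"
    and cont: "continuous_on UNIV (F k)" if "k < d" for k x
    using lift[OF that] by (auto simp: is_lift_def)
  have deg: "degree_one (F k)" if k: "k < d" for k
  proof -
    have "F k x < F k y" if "x < y" for x y
      using DERIV_pos_imp_increasing[OF that, of "F k"] deriv[OF k] pos[OF k] by blast
    then have "mono (F k)" by (simp add: strict_mono_def strict_mono_mono)
    then show ?thesis by (simp add: degree_one_def shift k)
  qed
  have comm: "F j (F k x) = F k (F j x)" if j: "j < d" and k: "k < d" for j k x
  proof -
    have "cis (2 * pi * F j (F k y)) = cis (2 * pi * F k (F j y))" for y
    proof -
      have "f j (f k (cis (2 * pi * y))) = f k (f j (cis (2 * pi * y)))" using assms(5) j k by simp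
      then show ?thesis by (simp add: cis j k)
    qed
    moreover have "continuous_on UNIV (\<lambda>x. F i (F l x))" if "i < d" "l < d" for i l
      by (rule continuous_on_compose2[OF cont cont]) (use that in auto)
    ultimately obtain c :: int where "\<And>x. F j (F k x) = F k (F j x) + of_int c"
      using lifts_differ_by_int[of "\<lambda>x. F j (F k x)" "\<lambda>x. F k (F j x)"] j k by blast
    then show ?thesis by (rule commute_up_to_int_imp_commute[OF deg[OF j] deg[OF k]])
  qed
  have "\<forall>k. \<exists>r::real. k < d \<longrightarrow> (\<forall>n x. \<bar>(F k ^^ n) x - x - n * r\<bar> \<le> 1) \<and> (\<lambda>n. (F k ^^ n) 0 / real n) \<longlonglongrightarrow> r"
    using translation_number_exists deg by metis
  then obtain \<rho> :: "nat \<Rightarrow> real" where \<rho>: "\<And>k n x. k < d \<Longrightarrow> \<bar>(F k ^^ n) x - x - n * \<rho> k\<bar> \<le> 1"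
    and lim: "\<And>k. k < d \<Longrightarrow> (\<lambda>n. (F k ^^ n) 0 / real n) \<longlonglongrightarrow> \<rho> k" by metis
  have rot: "rot_num (f k) = frac (\<rho> k)" if "k < d" for k
    using limI[OF lim[OF that]] by (simp add: rot_num_def F_def)
  \<comment> \<open>\<open>rot_num\<close> is the fractional part of the translation number, so an
    integer combination changes by an integer only.\<close>
  have indep: "z i = 0" if z: "(\<Sum>k<d. of_int (z k) * \<rho> k) = of_int m" and i: "i < d" for z :: "nat \<Rightarrow> int" and m i
  proof -
    have "(\<Sum>k<d. of_int (z k) * rot_num (f k)) = (\<Sum>k<d. of_int (z k) * \<rho> k) - (\<Sum>k<d. of_int (z k * \<lfloor>\<rho> k\<rfloor>))"
      by (simp add: sum_subtractf[symmetric] rot frac_def algebra_simps)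
    also have "\<dots> = of_int (m - (\<Sum>k<d. z k * \<lfloor>\<rho> k\<rfloor>))" unfolding z by simp
    finally have "(\<Sum>k<d. of_int (z k) * rot_num (f k)) \<in> \<rat>" by (simp only: Rats_of_int)
    moreover have "(\<forall>k<d. real_of_int (z k) \<in> \<rat>) \<and> (\<Sum>k<d. of_int (z k) * rot_num (f k)) \<in> \<rat>
        \<longrightarrow> (\<forall>k<d. real_of_int (z k) = 0)"
      using assms(6) unfolding rat_independent_def by (rule spec)
    ultimately have "\<forall>k<d. real_of_int (z k) = 0" by (meson Rats_of_int)
    then have "real_of_int (z i) = 0" using i by blast
    then show ?thesis by (simp only: of_int_eq_0_iff)
  qed
  interpret commuting_lifts d \<tau> F F' \<rho> "\<Sum>k<d. D k"
  proof
    show "ln (F' i x) - ln (F' i y) \<le> (\<Sum>k<d. D k) * \<bar>x - y\<bar> powr \<tau> i" if "i < d" for i x y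
    proof -
      have "D i \<le> (\<Sum>k<d. D k)" using D that by (intro member_le_sum) auto
      then have "D i * \<bar>x - y\<bar> powr \<tau> i \<le> (\<Sum>k<d. D k) * \<bar>x - y\<bar> powr \<tau> i" by (intro mult_right_mono) auto
      with dist[OF that, of x y] show ?thesis by linarith
    qed
    show "0 \<le> (\<Sum>k<d. D k)" using D by (intro sum_nonneg) auto
  qed (use assms shift deriv pos comm \<rho> indep in auto)
  obtain H where H: "degree_one H" "\<And>i x. i < d \<Longrightarrow> H (F i x) = H x + \<rho> i"
    using semiconjugacy_exists by blast
  interpret semiconjugate_lifts d \<tau> F F' \<rho> "\<Sum>k<d. D k" H
    by unfold_locales (use H in auto)
  obtain \<phi> \<psi> where hom: "homeomorphism S1 S1 \<phi> \<psi>" and \<phi>: "\<And>x. \<phi> (cis (2 * pi * x)) = cis (2 * pi * H x)"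
    using homeomorphism_of_lift[OF H(1) H_strict_mono H_continuous] by blast
  have "\<phi> (f k (\<psi> z)) = cis (2 * pi * \<rho> k) * z" if k: "k < d" and z: "z \<in> S1" for k z
  proof -
    have "\<psi> z \<in> S1" "\<phi> (\<psi> z) = z" using hom z by (auto simp: homeomorphism_def)
    then obtain x where x: "\<psi> z = cis (2 * pi * x)" using S1_cis by metis
    have "\<phi> (f k (\<psi> z)) = cis (2 * pi * (H x + \<rho> k))" by (simp add: x cis[OF k] \<phi> H(2)[OF k])
    also have "\<dots> = cis (2 * pi * \<rho> k) * cis (2 * pi * H x)" by (simp add: cis_mult algebra_simps)
    also have "cis (2 * pi * H x) = z" using \<open>\<phi> (\<psi> z) = z\<close> by (simp add: x \<phi>)
    finally show ?thesis .
  qed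
  then show ?thesis using hom by blast
qed

end
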